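(* Let $X$ be a separable Hilbert space, let $\mu_0 = \mathcal{N}_\Sigma$ be a nondegenerate centered Gaussian measure on $X$ (i.e. its covariance operator $\Sigma$ is injective), and let $\mu^y$ be a Borel probability measure on $X$ that is absolutely continuous with respect to $\mu_0$ with density $$\frac{\mathrm{d}\mu^y}{\mathrm{d}\mu_0}(u) = \frac{\exp(-\Phi(u))}{Z}$$ for some measurable function $\Phi: X \to \mathbb{R}$ and some constant $Z > 0$. Assume that (a) $\Phi$ is Lipschitz continuous on bounded sets: for every $r > 0$ there exists $L = L(r) > 0$ such that $|\Phi(x_1) - \Phi(x_2)| \le L\|x_1 - x_2\|_X$ for all $x_1, x_2 \in B_r(0)$; (b) there exists $\underline{L} \ge 0$ such that $\Phi(x) \ge \Phi(0) - \underline{L}\|x\|_X$ for all $x \in X$. Then: (i) The measure $\mu^y$ has a (strong) mode. (ii) A point $x \in X$ is a (strong) mode of $\mu^y$ if and only if it minimizes the Onsager--Machlup functional of $\mu^y$.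
   Context: $B_\varepsilon(x)$ denotes the open ball of radius $\varepsilon$ centred at $x$. Mode (strong mode): a point $\hat{x} \in X$ is a mode of a Borel probability measure $\mu$ on $X$ if $\lim_{\varepsilon \to 0} \frac{\mu(B_\varepsilon(\hat{x}))}{\sup_{x \in X}\mu(B_\varepsilon(x))} = 1$. Onsager--Machlup functional: let $E$ be the set of all $h \in X$ for which the shifted measure $\mu(\cdot - h)$ is equivalent to $\mu$ (mutually absolutely continuous). A functional $I: E \to \mathbb{R}$ is an Onsager--Machlup functional of $\mu$ if $\lim_{\varepsilon \to 0} \frac{\mu(B_\varepsilon(h_1))}{\mu(B_\varepsilon(h_2))} = \exp(I(h_2) - I(h_1))$ for all $h_1, h_2 \in E$. It is unique up to an additive constant, so its minimizers (which by definition lie in $E$) do not depend on the representative. In the setting of the claim, the paper identifies $E = \Sigma^{1/2}(X)$ (the range of $\Sigma^{1/2}$) and $I(x) = \Phi(x) + \frac12\|\Sigma^{-1/2}x\|_X^2$ for $x \in E$. *)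

theory Defs
  imports "HOL-Probability.Probability"
begin

text \<open>A real separable Hilbert space is a type of class \<open>{real_inner, polish_space}\<close>
  (completeness together with second countability, which for metric spaces is separability).\<close>

definition real_gaussian :: "real \<Rightarrow> real \<Rightarrow> real measure" where
  "real_gaussian m v =
     (if v = 0 then return borel m else density lborel (normal_density m (sqrt v)))"

text \<open>A Borel probability measure is Gaussian if all its one-dimensional marginals are Gaussian,
  possibly degenerate. By the Riesz representation theorem, the continuous linear functionals
  are the maps \<open>\<lambda>x. x \<bullet> h\<close>.\<close>

definition gaussian_measure :: "'a::{real_inner, polish_space} measure \<Rightarrow> bool" where
  "gaussian_measure M \<longleftrightarrow>
     prob_space M \<and> sets M = sets borel \<and>
     (\<forall>h. \<exists>m v. 0 \<le> v \<and> distr M borel (\<lambda>x. x \<bullet> h) = real_gaussian m v)"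

definition has_mean :: "'a::{real_inner, polish_space} measure \<Rightarrow> 'a \<Rightarrow> bool" where
  "has_mean M m \<longleftrightarrow>
     (\<forall>h. integrable M (\<lambda>x. x \<bullet> h) \<and> (LINT x|M. x \<bullet> h) = m \<bullet> h)"

text \<open>The integrability requirements here and in \<^term>\<open>has_mean\<close> hold automatically for Gaussian
  measures; they only exclude the default value 0 of a nonexistent integral.\<close>

definition has_covariance_operator ::
    "'a::{real_inner, polish_space} measure \<Rightarrow> ('a \<Rightarrow> 'a) \<Rightarrow> bool" where
  "has_covariance_operator M S \<longleftrightarrow> bounded_linear S \<and>
     (\<exists>m. has_mean M m \<and>
       (\<forall>h k. integrable M (\<lambda>x. ((x - m) \<bullet> h) * ((x - m) \<bullet> k)) \<and>
              (LINT x|M. ((x - m) \<bullet> h) * ((x - m) \<bullet> k)) = S h \<bullet> k))"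

definition centered_gaussian ::
    "'a::{real_inner, polish_space} measure \<Rightarrow> ('a \<Rightarrow> 'a) \<Rightarrow> bool" where
  "centered_gaussian M S \<longleftrightarrow>
     gaussian_measure M \<and> has_mean M 0 \<and> has_covariance_operator M S"

text \<open>If the supremum vanished, the quotient would be \<open>0 / 0 = 0\<close>, so the limit could not be 1;
  the same convention is harmless in the Onsager--Machlup functional below, as \<open>exp\<close> is never 0.\<close>

definition strong_mode :: "'a::{real_inner, polish_space} measure \<Rightarrow> 'a \<Rightarrow> bool" where
  "strong_mode M x \<longleftrightarrow>
     ((\<lambda>\<epsilon>. measure M (ball x \<epsilon>) / (SUP z. measure M (ball z \<epsilon>))) \<longlongrightarrow> 1) (at_right 0)"

text \<open>The measure \<open>A \<mapsto> M (A - h)\<close>.\<close>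

definition shifted_measure :: "'a::{real_inner, polish_space} measure \<Rightarrow> 'a \<Rightarrow> 'a measure" where
  "shifted_measure M h = distr M borel (\<lambda>x. x + h)"

definition equivalent_measures :: "'a measure \<Rightarrow> 'a measure \<Rightarrow> bool" where
  "equivalent_measures M N \<longleftrightarrow> absolutely_continuous M N \<and> absolutely_continuous N M"

definition equivalent_shifts :: "'a::{real_inner, polish_space} measure \<Rightarrow> 'a set" where
  "equivalent_shifts M = {h. equivalent_measures (shifted_measure M h) M}"

text \<open>Only the values of \<open>I\<close> on \<^term>\<open>equivalent_shifts M\<close> matter.\<close>

definition onsager_machlup ::
    "'a::{real_inner, polish_space} measure \<Rightarrow> ('a \<Rightarrow> real) \<Rightarrow> bool" where
  "onsager_machlup M I \<longleftrightarrow>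
     (\<forall>h1\<in>equivalent_shifts M. \<forall>h2\<in>equivalent_shifts M.
        ((\<lambda>\<epsilon>. measure M (ball h1 \<epsilon>) / measure M (ball h2 \<epsilon>)) \<longlongrightarrow> exp (I h2 - I h1))
          (at_right 0))"

end

theory Submission
  imports Defs
begin

text \<open>Let \<open>Q k = \<langle>S k, k\<rangle>\<close>. The Cameron--Martin formula for shifts by \<open>S k\<close>, together with
  Anderson's inequality for balls, gives
  \<open>M (ball z \<epsilon>) \<le> exp (- (\<langle>z, k\<rangle> - Q k / 2) + \<epsilon> \<parallel>k\<parallel>) M (ball 0 \<epsilon>)\<close> for every \<open>k\<close>. The supremum of
  \<open>\<langle>h, k\<rangle> - Q k / 2\<close> over \<open>k\<close> is the energy of \<open>h\<close>, half its squared Cameron--Martin norm, so that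
  neither the square root nor the spectral decomposition of \<open>S\<close> is needed. If \<open>M (ball z \<epsilon>) > 0\<close>,
  a near maximizer \<open>k\<close> of the negated exponent satisfies \<open>\<parallel>z - S k\<parallel> \<le> 2 \<epsilon>\<close> and
  \<open>M (ball z \<epsilon>) \<le> exp (- energy (S k)) M (ball 0 \<epsilon>)\<close>: small balls around arbitrary centres are
  controlled by nearby points of finite energy. Since \<open>\<Phi>\<close> is locally Lipschitz, the supremum of the
  posterior ball masses divided by \<open>M (ball 0 \<epsilon>)\<close> converges to \<open>exp (- min I) / Z\<close> for
  \<open>I = \<Phi> + energy\<close>. The minimum is attained because sets of bounded energy are compact.

  Anderson's inequality follows from the Prekopa--Leindler inequality, proved one direction at a
  time. The Gaussian structure enters through one fact: for \<open>k \<noteq> 0\<close> the coordinate \<open>\<langle>x, k\<rangle>\<close> may be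
  resampled independently of \<open>x - (\<langle>x, k\<rangle> / Q k) S k\<close>.\<close>

section \<open>Measures on a Hilbert space are determined by their characteristic functional\<close>

text \<open>The definition of a Gaussian measure speaks only of one-dimensional marginals, while
  independence and shifts concern joint laws. The bridge is that a law is determined by its
  characteristic functional. Two obstacles shape the rest. The centres in the supremum are arbitrary
  and may vary with the radius, whereas shifts outside the Cameron--Martin space have no density:
  hence a bound valid for every centre and every \<open>k\<close>, optimised over \<open>k\<close>
  only afterwards. Even for a shift inside that space, the density is in general the exponential of
  a functional defined only almost everywhere, which cannot be estimated pointwise on a ball. Shifts
  by \<open>S k\<close> are the exception, their exponent \<open>x \<bullet> k - Q k / 2\<close>
  being continuous in \<open>x\<close>; other points of finite energy are reached by approximation
  with points \<open>S k\<close> whose energy stays under control.\<close>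

lemma open_eq_countable_UN_cball:
  fixes S :: "'a::{metric_space,second_countable_topology} set"
  assumes "open S"
  shows "\<exists>I::('a \<times> rat) set. countable I \<and> S = (\<Union>(d,q)\<in>I. cball d (of_rat q))"
proof -
  obtain D :: "'a set" where D: "countable D" "\<And>X. open X \<Longrightarrow> X \<noteq> {} \<Longrightarrow> \<exists>d\<in>D. d \<in> X"
    using countable_dense_setE by blast
  let ?I = "{(d,q). d \<in> D \<and> cball d (of_rat q) \<subseteq> S}"
  have "countable (D \<times> (UNIV::rat set))" using D(1) by simp
  then have "countable ?I" by (rule countable_subset[rotated]) auto
  moreover have "S = (\<Union>(d,q)\<in>?I. cball d (of_rat q))"
  proof
    show "(\<Union>(d,q)\<in>?I. cball d (of_rat q)) \<subseteq> S" by auto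
    show "S \<subseteq> (\<Union>(d,q)\<in>?I. cball d (of_rat q))"
    proof
      fix x assume "x \<in> S"
      then obtain e where e: "e > 0" "ball x e \<subseteq> S" using assms open_contains_ball by blast
      obtain q :: rat where q: "0 < real_of_rat q" "real_of_rat q < e/2"
        using of_rat_dense[of 0 "e/2"] e by auto
      obtain d where d: "d \<in> D" "d \<in> ball x (of_rat q)"
        using D(2)[of "ball x (of_rat q)"] q by auto
      have "cball d (of_rat q) \<subseteq> ball x e"
      proof
        fix y assume "y \<in> cball d (of_rat q)"
        then show "y \<in> ball x e" using d q dist_triangle[of x y d] by auto
      qed
      then have "(d,q) \<in> ?I" using d e by auto
      moreover have "x \<in> cball d (of_rat q)" using d by (auto simp: dist_commute)
      ultimately show "x \<in> (\<Union>(d,q)\<in>?I. cball d (of_rat q))" by blast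
    qed
  qed
  ultimately show ?thesis by blast
qed

lemma dense_countable_enum:
  obtains d :: "nat \<Rightarrow> 'a::second_countable_topology"
  where "\<And>X. open X \<Longrightarrow> X \<noteq> {} \<Longrightarrow> \<exists>n. d n \<in> X"
proof -
  obtain D :: "'a set" where D: "countable D" "\<And>X. open X \<Longrightarrow> X \<noteq> {} \<Longrightarrow> \<exists>d\<in>D. d \<in> X"
    using countable_dense_setE by blast
  have "\<exists>d\<in>D. d \<in> (UNIV :: 'a set)" by (rule D(2)) simp_all
  then have "D \<noteq> {}" by blast
  then have r: "range (from_nat_into D) = D" using D(1) by (rule range_from_nat_into)
  show ?thesis
  proof (rule that)
    fix X :: "'a set" assume "open X" "X \<noteq> {}"
    then obtain x where "x \<in> D" "x \<in> X" using D(2) by blast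
    then show "\<exists>n. from_nat_into D n \<in> X" using r by (metis imageE)
  qed
qed

text \<open>The directions violating the inequality form an open set, which contains
  \<open>x\<close> itself if \<open>norm x > r \<ge> 0\<close>; a dense sequence would meet it.
  Closed balls thus become countable intersections of half-spaces.\<close>

lemma norm_le_iff_dense:
  fixes d :: "nat \<Rightarrow> 'a::{real_inner,second_countable_topology}"
  assumes d: "\<And>X. open X \<Longrightarrow> X \<noteq> {} \<Longrightarrow> \<exists>n. d n \<in> X"
  shows "norm x \<le> r \<longleftrightarrow> (0 \<le> r \<and> (\<forall>n. x \<bullet> d n \<le> r * norm (d n)))"
proof (intro iffI conjI allI)
  assume x: "norm x \<le> r"
  then show "0 \<le> r" using norm_ge_zero order_trans by blast
  fix n
  show "x \<bullet> d n \<le> r * norm (d n)"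
    using norm_cauchy_schwarz[of x "d n"] mult_right_mono[OF x, of "norm (d n)"] by simp
next
  assume A: "0 \<le> r \<and> (\<forall>n. x \<bullet> d n \<le> r * norm (d n))"
  have "open {y. x \<bullet> y > r * norm y}" by (intro open_Collect_less continuous_intros)
  then have "{y. x \<bullet> y > r * norm y} = {}" using d A by (metis (mono_tags, lifting) linorder_not_le mem_Collect_eq)
  then have "x \<bullet> x \<le> r * norm x" by (metis (mono_tags, lifting) empty_Collect_eq linorder_not_le)
  then show "norm x \<le> r" using A
    by (cases "x = 0") (auto simp: power2_norm_eq_inner[symmetric] power2_eq_square)
qed

text \<open>Finite intersections make the family stable under intersection, as uniqueness of
  measures on a generator requires; the empty one supplies \<open>UNIV\<close>.\<close>

definition halfspace_cylinders :: "'a::real_inner set set" where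
  "halfspace_cylinders = {A. \<exists>F. finite F \<and> A = {x. \<forall>(h,c)\<in>F. x \<bullet> h \<le> c}}"

text \<open>By separability an open set is a countable union of closed balls, and each of these is a
  countable intersection of half-spaces.\<close>

lemma sets_borel_halfspace_cylinders:
  "sets (borel :: 'a::{real_inner,second_countable_topology} measure) = sigma_sets UNIV halfspace_cylinders"
proof
  show "sigma_sets UNIV halfspace_cylinders \<subseteq> sets (borel::'a measure)"
  proof (rule sets.sigma_sets_subset[of _ borel, simplified])
    show "halfspace_cylinders \<subseteq> sets (borel::'a measure)"
    proof
      fix A :: "'a set" assume "A \<in> halfspace_cylinders"
      then obtain F where "finite F" "A = {x. \<forall>(h,c)\<in>F. x \<bullet> h \<le> c}"
        by (auto simp: halfspace_cylinders_def)
      then have "A = (\<Inter>(h,c)\<in>F. {x. x \<bullet> h \<le> c})" by auto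
      moreover have "closed \<dots>" by (intro closed_INT ballI) (auto intro!: closed_Collect_le continuous_intros)
      ultimately show "A \<in> sets borel" by simp
    qed
  qed
  interpret sigma_algebra "UNIV::'a set" "sigma_sets UNIV halfspace_cylinders"
    by (rule sigma_algebra_sigma_sets) auto
  have half: "{x. x \<bullet> h \<le> c} \<in> sigma_sets UNIV halfspace_cylinders" for h :: 'a and c
    by (rule sigma_sets.Basic) (auto simp: halfspace_cylinders_def intro!: exI[of _ "{(h,c)}"])
  obtain d :: "nat \<Rightarrow> 'a" where d: "\<And>X. open X \<Longrightarrow> X \<noteq> {} \<Longrightarrow> \<exists>n. d n \<in> X"
    using dense_countable_enum by blast
  have cb: "cball a r \<in> sigma_sets UNIV halfspace_cylinders" for a :: 'a and r
  proof (cases "0 \<le> r")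
    case True
    have "cball a r = (\<Inter>n. {x. x \<bullet> d n \<le> a \<bullet> d n + r * norm (d n)})"
      using norm_le_iff_dense[OF d, of "_ - a" r] True
      by (auto simp: dist_norm norm_minus_commute inner_diff_left algebra_simps)
    then show ?thesis using half by auto
  qed auto
  show "sets (borel::'a measure) \<subseteq> sigma_sets UNIV halfspace_cylinders"
    unfolding borel_def
  proof (subst sets_measure_of, simp, rule sigma_sets_subset, safe)
    fix S :: "'a set" assume "open S"
    then obtain I :: "('a \<times> rat) set" where "countable I" "S = (\<Union>(d,q)\<in>I. cball d (of_rat q))"
      using open_eq_countable_UN_cball by blast
    then show "S \<in> sigma_sets UNIV halfspace_cylinders"
      unfolding \<open>S = _\<close> by (intro countable_UN'[OF \<open>countable I\<close>]) (use cb in auto)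
  qed
qed

lemma iexp_eq_cos_sin: "iexp r = complex_of_real (cos r) + \<i> * complex_of_real (sin r)"
  by (simp add: complex_eq_iff Re_exp Im_exp)

text \<open>Normalise the weight to a probability density and push it forward under
  \<open>f\<close>: the hypotheses say that the two image laws have the same characteristic
  function, so Levy's uniqueness theorem applies. A total weight of 0 cannot be normalised, but then
  \<open>w\<close> vanishes almost everywhere on both sides.\<close>

lemma weighted_integral_atMost_eqI:
  fixes f :: "'a \<Rightarrow> real"
  assumes M: "finite_measure M" and N: "finite_measure N"
    and [measurable]: "f \<in> borel_measurable M" "w \<in> borel_measurable M"
         "f \<in> borel_measurable N" "w \<in> borel_measurable N"
    and w: "\<And>x. 0 \<le> w x" "\<And>x. w x \<le> B"
    and c: "\<And>t. (LINT x|M. w x * cos (t * f x)) = (LINT x|N. w x * cos (t * f x))"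
    and s: "\<And>t. (LINT x|M. w x * sin (t * f x)) = (LINT x|N. w x * sin (t * f x))"
  shows "(LINT x|M. w x * indicator {..b} (f x)) = (LINT x|N. w x * indicator {..b} (f x))"
proof -
  define m where "m = (LINT x|M. w x)"
  have mN: "m = (LINT x|N. w x)" using c[of 0] by (simp add: m_def)
  have iw: "integrable K w" if "finite_measure K" "w \<in> borel_measurable K" for K
    by (rule finite_measure.integrable_const_bound[of _ _ B]) (use that w in auto)
  have "0 \<le> m" using w by (simp add: m_def)
  show ?thesis
  proof (cases "m = 0")
    case True
    have z: "(LINT x|K. w x * indicator {..b} (f x)) = 0"
      if K: "finite_measure K" "w \<in> borel_measurable K" "f \<in> borel_measurable K" "(LINT x|K. w x) = 0" for K
    proof -
      have "AE x in K. w x = 0"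
        using integral_nonneg_eq_0_iff_AE[OF iw[OF K(1,2)]] w K(4) by simp
      then have "AE x in K. w x * indicator {..b} (f x) = (0::real)" by eventually_elim simp
      then show ?thesis by (simp add: integral_eq_zero_AE)
    qed
    have wM: "(LINT x|M. w x) = 0" using True by (simp add: m_def)
    have wN: "(LINT x|N. w x) = 0" using True mN by simp
    show ?thesis using z[OF M _ _ wM] z[OF N _ _ wN] by simp
  next
    case False
    with \<open>0 \<le> m\<close> have m: "m > 0" by simp
    define D where "D K = distr (density K (\<lambda>x. ennreal (w x / m))) borel f" for K
    have Dfacts: "real_distribution (D K) \<and>
        char (D K) = (\<lambda>t. complex_of_real ((LINT x|K. w x * cos (t * f x)) / m) + \<i> * complex_of_real ((LINT x|K. w x * sin (t * f x)) / m)) \<and>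
        measure (D K) {..b} = (LINT x|K. w x * indicator {..b} (f x)) / m"
      if K: "finite_measure K" and wK[measurable]: "w \<in> borel_measurable K" and fK[measurable]: "f \<in> borel_measurable K"
        and mK: "(LINT x|K. w x) = m" for K
    proof (intro conjI)
      interpret finite_measure K by fact
      have i0: "integrable K (\<lambda>x. w x / m)" using iw[OF K wK] by simp
      have "emeasure (density K (\<lambda>x. ennreal (w x / m))) (space K) = (\<integral>\<^sup>+x. ennreal (w x / m) \<partial>K)"
        by (subst emeasure_density) (auto intro!: nn_integral_cong)
      also have "\<dots> = ennreal (LINT x|K. w x / m)"
        by (rule nn_integral_eq_integral[OF i0]) (use w m in auto)
      also have "\<dots> = 1" using mK m by simp
      finally have pd: "prob_space (density K (\<lambda>x. ennreal (w x / m)))" by (intro prob_spaceI) simp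
      then have ps: "prob_space (D K)" unfolding D_def by (rule prob_space.prob_space_distr) simp
      then show "real_distribution (D K)"
        by (intro real_distribution.intro real_distribution_axioms.intro) (auto simp: D_def)
      have ib: "integrable K (\<lambda>x. w x * g x)" if "\<And>x. \<bar>g x\<bar> \<le> 1" "g \<in> borel_measurable K" for g :: "'a \<Rightarrow> real"
        by (rule Bochner_Integration.integrable_bound[OF iw[OF K wK]]) (use that w in \<open>auto simp: abs_mult mult_left_le\<close>)
      show "char (D K) = (\<lambda>t. complex_of_real ((LINT x|K. w x * cos (t * f x)) / m) + \<i> * complex_of_real ((LINT x|K. w x * sin (t * f x)) / m))"
      proof
        fix t
        have "char (D K) t = (CLINT x|K. (w x / m) *\<^sub>R iexp (t * f x))"
          unfolding char_def D_def
          by (subst integral_distr) (auto simp: integral_density w m less_imp_le)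
        also have "\<dots> = (CLINT x|K. complex_of_real (w x * cos (t * f x) / m) + \<i> * complex_of_real (w x * sin (t * f x) / m))"
          by (intro Bochner_Integration.integral_cong) (auto simp: iexp_eq_cos_sin scaleR_conv_of_real algebra_simps add_divide_distrib simp flip: of_real_mult)
        also have "\<dots> = complex_of_real ((LINT x|K. w x * cos (t * f x)) / m) + \<i> * complex_of_real ((LINT x|K. w x * sin (t * f x)) / m)"
          apply (subst Bochner_Integration.integral_add)
          using ib[of "\<lambda>x. cos (t * f x)"] ib[of "\<lambda>x. sin (t * f x)"]
          by (auto simp del: of_real_divide of_real_mult intro!: integrable_of_real)
        finally show "char (D K) t = \<dots>" .
      qed
      have "measure (D K) {..b} = (LINT x|D K. indicator {..b} x)"
        by (simp add: D_def)
      also have "\<dots> = (LINT x|K. (w x / m) *\<^sub>R indicator {..b} (f x))"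
        unfolding D_def
        by (subst integral_distr) (auto simp: integral_density w m less_imp_le)
      also have "\<dots> = (LINT x|K. w x * indicator {..b} (f x)) / m" by simp
      finally show "measure (D K) {..b} = \<dots>" .
    qed
    have "D M = D N"
      using Dfacts[OF M] Dfacts[OF N] c s mN m_def by (intro Levy_uniqueness) auto
    then have "(LINT x|M. w x * indicator {..b} (f x)) / m = (LINT x|N. w x * indicator {..b} (f x)) / m"
      using Dfacts[OF M] Dfacts[OF N] m_def mN by auto
    then show ?thesis using m by simp
  qed
qed

text \<open>Induction on the number of half-spaces: the weight \<open>1 + cos\<close> is nonnegative, so that the
  one-dimensional uniqueness theorem applies to it, and products of cosines are linear in cosines
  again.\<close>

theorem measure_eqI_char_functional:
  fixes M N :: "'a::{real_inner,second_countable_topology} measure"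
  assumes M: "prob_space M" "sets M = sets borel" and N: "prob_space N" "sets N = sets borel"
    and eq: "\<And>h. (CLINT x|M. iexp (x \<bullet> h)) = (CLINT x|N. iexp (x \<bullet> h))"
  shows "M = N"
proof -
  interpret M: prob_space M by fact
  interpret N: prob_space N by fact
  note [measurable_cong] = M(2) N(2)
  have cyl: "A \<in> sets borel" if "A \<in> halfspace_cylinders" for A :: "'a set"
    using that by (auto simp: sets_borel_halfspace_cylinders)
  have base: "(LINT x|M. cos (x \<bullet> k + t)) = (LINT x|N. cos (x \<bullet> k + t))" for k t
  proof -
    have *: "(CLINT x|K. iexp (x \<bullet> k)) = complex_of_real (LINT x|K. cos (x \<bullet> k)) + \<i> * complex_of_real (LINT x|K. sin (x \<bullet> k)) \<and>
         (LINT x|K. cos (x \<bullet> k + t)) = cos t * (LINT x|K. cos (x \<bullet> k)) - sin t * (LINT x|K. sin (x \<bullet> k))"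
      if "prob_space K" and [measurable_cong]: "sets K = sets borel" for K :: "'a measure"
    proof -
      interpret prob_space K by fact
      have i: "integrable K (\<lambda>x. cos (x \<bullet> k))" "integrable K (\<lambda>x. sin (x \<bullet> k))"
        by (rule integrable_const_bound[of _ 1]; auto)+
      have "(CLINT x|K. iexp (x \<bullet> k)) = (CLINT x|K. complex_of_real (cos (x \<bullet> k)) + \<i> * complex_of_real (sin (x \<bullet> k)))"
        by (intro Bochner_Integration.integral_cong) (rule refl | rule iexp_eq_cos_sin)+
      also have "\<dots> = complex_of_real (LINT x|K. cos (x \<bullet> k)) + \<i> * complex_of_real (LINT x|K. sin (x \<bullet> k))"
        by (subst Bochner_Integration.integral_add) (use i in \<open>auto intro!: integrable_of_real\<close>)
      finally have 1: "(CLINT x|K. iexp (x \<bullet> k)) = \<dots>" .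
      show ?thesis using 1 i by (auto simp: cos_add algebra_simps)
    qed
    from *[OF M] *[OF N] eq[of k] show ?thesis
      by (auto simp: complex_eq_iff)
  qed
  have P: "\<forall>k t. (LINT x|M. indicator {x. \<forall>(h,c)\<in>F. x \<bullet> h \<le> c} x * cos (x \<bullet> k + t)) =
       (LINT x|N. indicator {x. \<forall>(h,c)\<in>F. x \<bullet> h \<le> c} x * cos (x \<bullet> k + t))" if "finite F" for F
    using that
  proof induction
    case empty
    then show ?case using base by simp
  next
    case (insert p F)
    obtain h c where p: "p = (h,c)" by force
    define A where "A = {x::'a. \<forall>(h,c)\<in>F. x \<bullet> h \<le> c}"
    have A[measurable]: "A \<in> sets borel"
      using insert(1) by (intro cyl) (auto simp: halfspace_cylinders_def A_def)
    have IH: "(LINT x|M. indicator A x * cos (x \<bullet> k + t)) = (LINT x|N. indicator A x * cos (x \<bullet> k + t))" for k t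
      using insert by (auto simp: A_def)
    have ins: "indicator {x. \<forall>(h,c)\<in>insert p F. x \<bullet> h \<le> c} x = indicator A x * (indicator {..c} (x \<bullet> h) :: real)" for x
      by (auto simp: p A_def indicator_def)
    have ii: "integrable M (\<lambda>x. indicator A x * cos (x \<bullet> k + t))" "integrable N (\<lambda>x. indicator A x * cos (x \<bullet> k + t))" for k t
      by (rule M.integrable_const_bound[of _ 1] N.integrable_const_bound[of _ 1]; auto split: split_indicator)+
    have step: "(LINT x|M. (indicator A x * (1 + cos (x \<bullet> k + t))) * indicator {..c} (x \<bullet> h)) =
         (LINT x|N. (indicator A x * (1 + cos (x \<bullet> k + t))) * indicator {..c} (x \<bullet> h))" for k t
    proof (rule weighted_integral_atMost_eqI[where B=2])
      show "finite_measure M" "finite_measure N" by unfold_locales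
      show "0 \<le> indicator A x * (1 + cos (x \<bullet> k + t))" for x
        using cos_ge_minus_one[of "x \<bullet> k + t"] by (auto simp del: cos_ge_minus_one split: split_indicator)
      show "indicator A x * (1 + cos (x \<bullet> k + t)) \<le> 2" for x
        using cos_le_one[of "x \<bullet> k + t"] by (auto simp del: cos_le_one split: split_indicator)
      \<comment> \<open>The phase \<open>r\<close> serves both trigonometric hypotheses at once:
        \<open>r = 0\<close> gives the cosine, \<open>r = - pi/2\<close> the sine.\<close>
      have cc: "indicator A x * (1 + cos (x \<bullet> k + t)) * cos (s * (x \<bullet> h) + r) =
         indicator A x * cos (x \<bullet> (s *\<^sub>R h) + r) + (1/2) * (indicator A x * cos (x \<bullet> (k - s *\<^sub>R h) + (t-r)))
          + (1/2) * (indicator A x * cos (x \<bullet> (k + s *\<^sub>R h) + (t+r)))" for x s and r :: real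
        by (simp add: cos_times_cos algebra_simps inner_diff_right inner_add_right)
      have eq: "(LINT x|M. indicator A x * (1 + cos (x \<bullet> k + t)) * cos (s * (x \<bullet> h) + r)) =
        (LINT x|N. indicator A x * (1 + cos (x \<bullet> k + t)) * cos (s * (x \<bullet> h) + r))" for s r
        unfolding cc using ii by (simp add: IH del: inner_scaleR_right)
      show "(LINT x|M. indicator A x * (1 + cos (x \<bullet> k + t)) * cos (s * (x \<bullet> h))) =
        (LINT x|N. indicator A x * (1 + cos (x \<bullet> k + t)) * cos (s * (x \<bullet> h)))" for s
        using eq[of s 0] by simp
      have sc: "sin y = cos (y + (- pi/2))" for y :: real by (simp only: cos_add) simp
      show "(LINT x|M. indicator A x * (1 + cos (x \<bullet> k + t)) * sin (s * (x \<bullet> h))) =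
        (LINT x|N. indicator A x * (1 + cos (x \<bullet> k + t)) * sin (s * (x \<bullet> h)))" for s
        unfolding sc[of "s * _"] by (rule eq)
    qed measurable
    have jj: "integrable M (\<lambda>x. indicator A x * indicator {..c} (x \<bullet> h) * cos (x \<bullet> k + t))"
        "integrable N (\<lambda>x. indicator A x * indicator {..c} (x \<bullet> h) * cos (x \<bullet> k + t))"
        "integrable M (\<lambda>x. indicator A x * indicator {..c} (x \<bullet> h)::real)"
        "integrable N (\<lambda>x. indicator A x * indicator {..c} (x \<bullet> h)::real)" for k t
      by (rule M.integrable_const_bound[of _ 1] N.integrable_const_bound[of _ 1]; auto split: split_indicator)+
    have e: "(indicator A x * (1 + cos (x \<bullet> k + t))) * indicator {..c} (x \<bullet> h) =
       indicator A x * indicator {..c} (x \<bullet> h) + indicator A x * indicator {..c} (x \<bullet> h) * cos (x \<bullet> k + t)" for x k t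
      by (simp add: algebra_simps)
    have st: "(LINT x|M. indicator A x * indicator {..c} (x \<bullet> h)) + (LINT x|M. indicator A x * indicator {..c} (x \<bullet> h) * cos (x \<bullet> k + t))
       = (LINT x|N. indicator A x * indicator {..c} (x \<bullet> h)) + (LINT x|N. indicator A x * indicator {..c} (x \<bullet> h) * cos (x \<bullet> k + t))" for k t
      using step[of k t] unfolding e using jj by simp
    \<comment> \<open>For \<open>k = 0\<close> and \<open>t = 0\<close> the cosine is 1, so
      \<open>st\<close> equates twice the plain integrals; subtracting them from \<open>st\<close>
      isolates the cosine term.\<close>
    have "(LINT x|M. indicator A x * indicator {..c} (x \<bullet> h)) = (LINT x|N. indicator A x * indicator {..c} (x \<bullet> h)::real)"
      using st[of 0 0] by simp
    then show ?case using st unfolding ins by simp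
  qed
  show ?thesis
  proof (rule measure_eqI_generator_eq[where \<Omega>=UNIV and E=halfspace_cylinders and A="\<lambda>_. UNIV"])
    show "Int_stable (halfspace_cylinders :: 'a set set)"
    proof (rule Int_stableI)
      fix a b :: "'a set" assume "a \<in> halfspace_cylinders" "b \<in> halfspace_cylinders"
      then obtain F G where "finite F" "a = {x. \<forall>(h,c)\<in>F. x \<bullet> h \<le> c}" "finite G" "b = {x. \<forall>(h,c)\<in>G. x \<bullet> h \<le> c}"
        by (auto simp: halfspace_cylinders_def)
      then show "a \<inter> b \<in> halfspace_cylinders"
        by (auto simp: halfspace_cylinders_def intro!: exI[of _ "F \<union> G"])
    qed
    fix X :: "'a set" assume X: "X \<in> halfspace_cylinders"
    then obtain F where F: "finite F" "X = {x. \<forall>(h,c)\<in>F. x \<bullet> h \<le> c}"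
      by (auto simp: halfspace_cylinders_def)
    have "measure M X = measure N X"
      using P[OF F(1), rule_format, of 0 0] cyl[OF X] M(2) N(2) unfolding F(2)[symmetric] by simp
    then show "emeasure M X = emeasure N X" by (simp add: M.emeasure_eq_measure N.emeasure_eq_measure)
  next
    show "range (\<lambda>_. UNIV :: 'a set) \<subseteq> halfspace_cylinders"
      by (auto simp: halfspace_cylinders_def intro!: exI[of _ "{}"])
  qed (use sets_borel_halfspace_cylinders M(2) N(2) M.emeasure_finite in auto)
qed

section \<open>Nondegenerate Gaussian measures and the Cameron--Martin formula\<close>

definition centered_normal :: "real \<Rightarrow> real measure" where
  "centered_normal v = density lborel (normal_density 0 (sqrt v))"

lemma sets_centered_normal [simp, measurable_cong]: "sets (centered_normal v) = sets borel"
  by (simp add: centered_normal_def)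

lemma prob_space_centered_normal: "v > 0 \<Longrightarrow> prob_space (centered_normal v)"
  unfolding centered_normal_def by (rule prob_space_normal_density) simp

lemma char_centered_normal:
  assumes "v > 0"
  shows "(CLINT y|centered_normal v. iexp (t * y)) = exp (- (v * t\<^sup>2) / 2)"
proof -
  have ps: "prob_space (density lborel (normal_density 0 1))" by (rule prob_space_normal_density) simp
  have d: "distributed (density lborel (normal_density 0 1)) lborel (\<lambda>x. x) (normal_density 0 1)"
    by (auto simp: distributed_def distr_id2)
  have "distributed (density lborel (normal_density 0 1)) lborel (\<lambda>x. 0 + sqrt v * x) (normal_density (0 + sqrt v * 0) (\<bar>sqrt v\<bar> * 1))"
    by (rule prob_space.normal_density_affine[OF ps d]) (use assms in auto)
  then have "centered_normal v = distr std_normal_distribution lborel (\<lambda>x. sqrt v * x)"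
    using assms by (simp add: distributed_def centered_normal_def)
  then have "(CLINT y|centered_normal v. iexp (t * y)) = (CLINT y|std_normal_distribution. iexp ((t * sqrt v) * y))"
    by (simp add: integral_distr mult.assoc)
  also have "\<dots> = char std_normal_distribution (t * sqrt v)" by (simp add: char_def)
  also have "\<dots> = exp (- (v * t\<^sup>2) / 2)"
    using assms by (simp add: char_std_normal_distribution power_mult_distrib exp_of_real mult.commute)
  finally show ?thesis .
qed

text \<open>The one-dimensional Cameron--Martin formula, by completing the square. The shift equals
  the variance because translation by \<open>S k\<close> moves the coordinate
  \<open>x \<bullet> k\<close>, of variance \<open>Q k\<close>, by exactly
  \<open>Q k\<close>.\<close>

lemma nn_integral_centered_normal_shift:
  assumes v: "v > 0" and [measurable]: "g \<in> borel_measurable borel"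
  shows "(\<integral>\<^sup>+y. g (y + v) \<partial>centered_normal v) = (\<integral>\<^sup>+y. g y * ennreal (exp (y - v / 2)) \<partial>centered_normal v)"
proof -
  have n: "normal_density 0 (sqrt v) (y - v) = normal_density 0 (sqrt v) y * exp (y - v / 2)" for y
  proof -
    have "- (y - v)\<^sup>2 / (2 * v) = - y\<^sup>2 / (2 * v) + (y - v / 2)"
      using v by (simp add: field_simps power2_eq_square)
    then show ?thesis using v by (simp add: normal_density_def exp_add[symmetric])
  qed
  have "(\<integral>\<^sup>+y. g y * ennreal (exp (y - v / 2)) \<partial>centered_normal v) =
     (\<integral>\<^sup>+y. ennreal (normal_density 0 (sqrt v) (y - v)) * g y \<partial>lborel)"
    unfolding centered_normal_def n
    by (subst nn_integral_density) (auto intro!: nn_integral_cong simp: ennreal_mult mult_ac)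
  also have "\<dots> = (\<integral>\<^sup>+y. ennreal (normal_density 0 (sqrt v) y) * g (v + y) \<partial>lborel)"
    by (subst nn_integral_real_affine[of _ 1 v]) auto
  also have "\<dots> = (\<integral>\<^sup>+y. g (y + v) \<partial>centered_normal v)"
    unfolding centered_normal_def
    by (subst nn_integral_density) (auto intro!: nn_integral_cong simp: add.commute)
  finally show ?thesis by simp
qed

lemma real_gaussian_mean:
  assumes "0 \<le> v"
  shows "(LINT y|real_gaussian m v. y) = m"
proof (cases "v = 0")
  case False
  with assms have "sqrt v > 0" by simp
  then show ?thesis using False
    by (simp add: real_gaussian_def integral_density integral_normal_moment_nz_1)
qed (simp add: real_gaussian_def integral_return)

lemma real_gaussian_second_moment:
  assumes "0 \<le> v"
  shows "(LINT y|real_gaussian 0 v. y\<^sup>2) = v"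
proof (cases "v = 0")
  case False
  with assms have "sqrt v > 0" by simp
  then show ?thesis using False assms integral_normal_moment_even[of "sqrt v" 0 1]
    by (simp add: real_gaussian_def integral_density fact_numeral)
qed (simp add: real_gaussian_def integral_return)

section \<open>Covariance form, characteristic functional and resampling\<close>

locale nondegenerate_gaussian =
  fixes M :: "'a::{real_inner, polish_space} measure" and S :: "'a \<Rightarrow> 'a"
  assumes gaussian: "centered_gaussian M S" and inj: "inj S"
begin

sublocale prob_space M
  using gaussian by (simp add: centered_gaussian_def gaussian_measure_def)

lemma sets_M [simp, measurable_cong]: "sets M = sets borel"
  using gaussian by (simp add: centered_gaussian_def gaussian_measure_def)

lemma space_M [simp]: "space M = UNIV"
  using sets_eq_imp_space_eq[OF sets_M] by simp

lemma S_bounded_linear: "bounded_linear S"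
  using gaussian by (simp add: centered_gaussian_def has_covariance_operator_def)

lemma S_simps: "S (x + y) = S x + S y" "S (c *\<^sub>R x) = c *\<^sub>R S x" "S (- x) = - S x" "S (x - y) = S x - S y" "S 0 = 0"
  using bounded_linear.linear[OF S_bounded_linear]
  by (auto simp: linear_add linear_scale linear_neg linear_diff linear_0)

lemma integral_inner: "(LINT x|M. x \<bullet> h) = 0"
  using gaussian by (simp add: centered_gaussian_def has_mean_def)

text \<open>The mean in the definition of the covariance operator is existentially quantified on its
  own; testing it against itself shows that it is 0.\<close>

lemma covariance:
  "integrable M (\<lambda>x. (x \<bullet> h) * (x \<bullet> k))" "(LINT x|M. (x \<bullet> h) * (x \<bullet> k)) = S h \<bullet> k"
proof -
  obtain m where m: "has_mean M m"
    "\<And>h k. integrable M (\<lambda>x. ((x - m) \<bullet> h) * ((x - m) \<bullet> k))"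
    "\<And>h k. (LINT x|M. ((x - m) \<bullet> h) * ((x - m) \<bullet> k)) = S h \<bullet> k"
    using gaussian by (auto simp: centered_gaussian_def has_covariance_operator_def)
  have "m \<bullet> m = 0" using m(1) integral_inner[of m] by (auto simp: has_mean_def)
  then have "m = 0" by simp
  then show "integrable M (\<lambda>x. (x \<bullet> h) * (x \<bullet> k))" "(LINT x|M. (x \<bullet> h) * (x \<bullet> k)) = S h \<bullet> k"
    using m(2,3) by auto
qed

lemma S_sym: "S h \<bullet> k = h \<bullet> S k"
  using covariance(2)[of h k] covariance(2)[of k h] by (simp add: mult.commute inner_commute)

definition Q :: "'a \<Rightarrow> real" where "Q k = S k \<bullet> k"

lemma Q_nonneg [simp]: "0 \<le> Q k"
  unfolding Q_def covariance(2)[symmetric] by simp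

text \<open>If \<open>Q k = 0\<close>, then \<open>x \<bullet> k\<close> vanishes almost surely,
  hence so does its covariance with \<open>x \<bullet> S k\<close>, which is the squared norm of
  \<open>S k\<close>. Injectivity of \<open>S\<close> then forces \<open>k = 0\<close>.\<close>

lemma Q_pos: assumes "k \<noteq> 0" shows "0 < Q k"
proof (rule ccontr)
  assume "\<not> 0 < Q k"
  then have "Q k = 0" using Q_nonneg[of k] by linarith
  then have "(LINT x|M. (x \<bullet> k) * (x \<bullet> k)) = 0" by (simp add: covariance Q_def)
  then have ae: "AE x in M. (x \<bullet> k) * (x \<bullet> k) = 0"
    using integral_nonneg_eq_0_iff_AE[OF covariance(1)[of k k]] by simp
  have "S k \<bullet> S k = (LINT x|M. (x \<bullet> k) * (x \<bullet> S k))" by (simp add: covariance)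
  also have "\<dots> = 0" by (rule integral_eq_zero_AE) (use ae in eventually_elim, simp)
  finally have "S k = S 0" by (simp add: S_simps)
  then show False using inj assms by (simp add: inj_eq)
qed

lemma Q_simps: "Q (k + h) = Q k + 2 * (S k \<bullet> h) + Q h" "Q (c *\<^sub>R k) = c\<^sup>2 * Q k" "Q (- k) = Q k" "Q 0 = 0"
  using S_sym[of k h] by (auto simp: Q_def S_simps inner_add power2_eq_square inner_commute)

text \<open>The parameters of the marginal law are unspecified in the definition; its first two
  moments identify them as 0 and \<open>Q h\<close>.\<close>

lemma char_functional: "(CLINT x|M. iexp (x \<bullet> h)) = exp (- Q h / 2)"
proof -
  obtain m v where mv: "0 \<le> v" "distr M borel (\<lambda>x. x \<bullet> h) = real_gaussian m v"
    using gaussian unfolding centered_gaussian_def gaussian_measure_def by blast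
  have e: "(LINT x|M. g (x \<bullet> h)) = (LINT y|real_gaussian m v. g y)" if "g \<in> borel_measurable borel"
    for g :: "real \<Rightarrow> 'c::{banach, second_countable_topology}"
    unfolding mv(2)[symmetric] using that by (subst integral_distr) auto
  have m: "m = 0" using e[of "\<lambda>y. y"] integral_inner[of h] real_gaussian_mean[OF mv(1), of m] by simp
  have v: "v = Q h" using e[of "\<lambda>y. y\<^sup>2"] covariance(2)[of h h] real_gaussian_second_moment[OF mv(1)]
    by (simp add: m Q_def power2_eq_square)
  have "(CLINT x|M. iexp (x \<bullet> h)) = (CLINT y|real_gaussian 0 v. iexp y)"
    using e[of iexp] m by simp
  also have "\<dots> = exp (- Q h / 2)"
  proof (cases "v = 0")
    case True
    then show ?thesis using v by (simp add: real_gaussian_def integral_return)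
  next
    case False
    then show ?thesis using char_centered_normal[of v 1] mv(1) v
      by (simp add: real_gaussian_def centered_normal_def)
  qed
  finally show ?thesis .
qed

lemma distr_uminus: "distr M borel uminus = M"
proof (rule measure_eqI_char_functional)
  show "prob_space (distr M borel uminus)" by (rule prob_space_distr) simp
  show "(CLINT x|distr M borel uminus. iexp (x \<bullet> h)) = (CLINT x|M. iexp (x \<bullet> h))" for h
    using char_functional[of h] char_functional[of "- h"]
    by (subst integral_distr) (simp_all add: Q_simps)
qed (simp_all add: prob_space_axioms)

text \<open>The regression coefficient of \<open>x\<close> on \<open>x \<bullet> k\<close>:
  covariance over variance. For \<open>k \<noteq> 0\<close> it satisfies
  \<open>dir k \<bullet> k = 1\<close>, so that \<open>recombine k x y \<bullet> k = y\<close>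
  whatever \<open>x\<close> is.\<close>

definition dir :: "'a \<Rightarrow> 'a" where "dir k = (1 / Q k) *\<^sub>R S k"

definition recombine :: "'a \<Rightarrow> 'a \<Rightarrow> real \<Rightarrow> 'a" where
  "recombine k x y = x - (x \<bullet> k) *\<^sub>R dir k + y *\<^sub>R dir k"

lemma recombine_inner: "recombine k x y \<bullet> h = x \<bullet> (h - (dir k \<bullet> h) *\<^sub>R k) + y * (dir k \<bullet> h)"
  by (simp add: recombine_def inner_add_left inner_diff_left inner_diff_right)

lemma recombine_measurable [measurable]: "case_prod (recombine k) \<in> borel_measurable (borel \<Otimes>\<^sub>M borel)"
  unfolding recombine_def[abs_def] by measurable

text \<open>Under a centred Gaussian measure, \<open>x - (x \<bullet> k) dir k\<close> and \<open>x \<bullet> k\<close> are uncorrelated, hence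
  independent: replacing \<open>x \<bullet> k\<close> by an independent copy does not change the law.\<close>

lemma distr_recombine:
  assumes "k \<noteq> 0"
  shows "distr (M \<Otimes>\<^sub>M centered_normal (Q k)) borel (\<lambda>(x,y). recombine k x y) = M"
proof -
  have q: "Q k > 0" using Q_pos[OF assms] .
  interpret N: prob_space "centered_normal (Q k)" by (rule prob_space_centered_normal[OF q])
  interpret MN: pair_prob_space M "centered_normal (Q k)" ..
  show ?thesis
  proof (rule measure_eqI_char_functional)
    show "prob_space (distr (M \<Otimes>\<^sub>M centered_normal (Q k)) borel (\<lambda>(x,y). recombine k x y))"
      by (rule MN.prob_space_distr) measurable
    fix h
    define h' where "h' = h - (dir k \<bullet> h) *\<^sub>R k"
    define b where "b = dir k \<bullet> h"
    have e: "recombine k x y \<bullet> h = x \<bullet> h' + b * y" for x y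
      by (simp add: recombine_inner h'_def b_def)
    have Sk: "S k \<bullet> h = Q k * b" using q by (simp add: b_def dir_def)
    \<comment> \<open>The variance of \<open>x \<bullet> h\<close> splits into those of the residual
      and of the resampled coordinate; at the level of characteristic functionals this is the
      independence.\<close>
    have Qh: "Q h' + Q k * b\<^sup>2 = Q h"
    proof -
      have "Q h' = Q (h + (- b) *\<^sub>R k)" by (simp add: h'_def b_def)
      also have "\<dots> = Q h - 2 * b * (S h \<bullet> k) + b\<^sup>2 * Q k" by (subst Q_simps(1), subst Q_simps(2)) simp
      also have "S h \<bullet> k = Q k * b" using Sk S_sym[of h k] by (simp add: inner_commute)
      finally show ?thesis by (simp add: power2_eq_square)
    qed
    have "(CLINT x|distr (M \<Otimes>\<^sub>M centered_normal (Q k)) borel (\<lambda>(x,y). recombine k x y). iexp (x \<bullet> h))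
       = (CLINT p|(M \<Otimes>\<^sub>M centered_normal (Q k)). iexp (fst p \<bullet> h') * iexp (b * snd p))"
      by (subst integral_distr)
         (auto intro!: Bochner_Integration.integral_cong simp: e exp_add[symmetric] distrib_left)
    also have "\<dots> = (CLINT x|M. (CLINT y|centered_normal (Q k). iexp (x \<bullet> h') * iexp (b * y)))"
    proof (subst MN.integral_fst'[symmetric])
      show "integrable (M \<Otimes>\<^sub>M centered_normal (Q k)) (\<lambda>p. iexp (fst p \<bullet> h') * iexp (b * snd p))"
        by (rule MN.integrable_const_bound[of _ 1]) (auto simp: norm_mult)
    qed simp
    also have "\<dots> = (CLINT x|M. iexp (x \<bullet> h')) * (CLINT y|centered_normal (Q k). iexp (b * y))"
      by simp
    also have "\<dots> = complex_of_real (exp (- Q h' / 2) * exp (- (Q k * b\<^sup>2) / 2))"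
      unfolding char_functional char_centered_normal[OF q] by simp
    also have "exp (- Q h' / 2) * exp (- (Q k * b\<^sup>2) / 2) = exp (- Q h / 2)"
      by (simp add: Qh[symmetric] exp_add[symmetric] add_divide_distrib)
    also have "complex_of_real \<dots> = (CLINT x|M. iexp (x \<bullet> h))" by (simp add: char_functional)
    finally show "(CLINT x|distr (M \<Otimes>\<^sub>M centered_normal (Q k)) borel (\<lambda>(x,y). recombine k x y). iexp (x \<bullet> h)) = \<dots>" .
  qed (simp_all add: prob_space_axioms)
qed

lemma nn_integral_recombine:
  assumes "k \<noteq> 0" and [measurable]: "f \<in> borel_measurable borel"
  shows "(\<integral>\<^sup>+x. f x \<partial>M) = (\<integral>\<^sup>+x. \<integral>\<^sup>+y. f (recombine k x y) \<partial>centered_normal (Q k) \<partial>M)"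
proof -
  interpret N: prob_space "centered_normal (Q k)" by (rule prob_space_centered_normal[OF Q_pos[OF assms(1)]])
  have "(\<integral>\<^sup>+x. f x \<partial>M) = (\<integral>\<^sup>+x. f x \<partial>distr (M \<Otimes>\<^sub>M centered_normal (Q k)) borel (\<lambda>(x,y). recombine k x y))"
    by (simp add: distr_recombine[OF assms(1)])
  also have "\<dots> = (\<integral>\<^sup>+p. f (recombine k (fst p) (snd p)) \<partial>(M \<Otimes>\<^sub>M centered_normal (Q k)))"
    by (subst nn_integral_distr) (auto simp: case_prod_beta)
  also have "\<dots> = (\<integral>\<^sup>+x. \<integral>\<^sup>+y. f (recombine k x y) \<partial>centered_normal (Q k) \<partial>M)"
    by (subst N.nn_integral_fst[symmetric]) auto
  finally show ?thesis .
qed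

lemma integral_recombine:
  fixes f :: "'a \<Rightarrow> real"
  assumes "k \<noteq> 0" and [measurable]: "f \<in> borel_measurable borel" and b: "\<And>x. \<bar>f x\<bar> \<le> B"
  shows "(LINT x|M. f x) = (LINT x|M. LINT y|centered_normal (Q k). f (recombine k x y))"
proof -
  interpret N: prob_space "centered_normal (Q k)" by (rule prob_space_centered_normal[OF Q_pos[OF assms(1)]])
  interpret MN: pair_prob_space M "centered_normal (Q k)" ..
  have "(LINT x|M. f x) = (LINT x|distr (M \<Otimes>\<^sub>M centered_normal (Q k)) borel (\<lambda>(x,y). recombine k x y). f x)"
    by (simp add: distr_recombine[OF assms(1)])
  also have "\<dots> = (LINT p|(M \<Otimes>\<^sub>M centered_normal (Q k)). f (recombine k (fst p) (snd p)))"
    by (subst integral_distr) (auto simp: case_prod_beta)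
  also have "\<dots> = (LINT x|M. LINT y|centered_normal (Q k). f (recombine k x y))"
  proof (subst MN.integral_fst'[symmetric])
    show "integrable (M \<Otimes>\<^sub>M centered_normal (Q k)) (\<lambda>p. f (recombine k (fst p) (snd p)))"
      by (rule MN.integrable_const_bound[of _ B]) (use b in auto)
  qed simp
  finally show ?thesis .
qed

text \<open>\<open>S k\<close> is \<open>Q k\<close> times \<open>dir k\<close>, so the translation
  acts on the resampled coordinate alone and the one-dimensional formula applies for each fixed
  residual.\<close>

lemma cameron_martin:
  assumes [measurable]: "f \<in> borel_measurable borel"
  shows "(\<integral>\<^sup>+x. f (x + S k) \<partial>M) = (\<integral>\<^sup>+x. f x * ennreal (exp (x \<bullet> k - Q k / 2)) \<partial>M)"
proof (cases "k = 0")
  case True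
  then show ?thesis by (simp add: S_simps Q_simps)
next
  case False
  then have q: "Q k > 0" by (rule Q_pos)
  have dk: "dir k \<bullet> k = 1" using q by (simp add: dir_def Q_def)
  have sh: "recombine k x y + S k = recombine k x (y + Q k)" for x y
    using q by (simp add: recombine_def dir_def add_divide_distrib scaleR_add_left)
  have ik: "recombine k x y \<bullet> k = y" for x y by (simp add: recombine_inner dk)
  have "(\<integral>\<^sup>+x. f (x + S k) \<partial>M) = (\<integral>\<^sup>+x. \<integral>\<^sup>+y. f (recombine k x (y + Q k)) \<partial>centered_normal (Q k) \<partial>M)"
    by (subst nn_integral_recombine[OF False]) (auto simp: sh)
  also have "\<dots> = (\<integral>\<^sup>+x. \<integral>\<^sup>+y. f (recombine k x y) * ennreal (exp (y - Q k / 2)) \<partial>centered_normal (Q k) \<partial>M)"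
    by (intro nn_integral_cong nn_integral_centered_normal_shift[OF q]) simp
  also have "\<dots> = (\<integral>\<^sup>+x. f x * ennreal (exp (x \<bullet> k - Q k / 2)) \<partial>M)"
    by (subst (2) nn_integral_recombine[OF False]) (auto simp: ik)
  finally show ?thesis .
qed

end

section \<open>The inequalities of Prekopa--Leindler and Anderson\<close>

text \<open>Cut points have to lie in \<open>A\<close>, which may lack a largest element. The
  sequence \<open>t\<close> climbs to the supremum of \<open>A\<close>, or to infinity, and misses
  at most the supremum itself, a null set.\<close>

lemma emeasure_lborel_add_le_Int_atMost:
  fixes A :: "real set"
  assumes A[measurable]: "A \<in> sets borel" and ne: "A \<noteq> {}"
    and le: "\<And>a. a \<in> A \<Longrightarrow> emeasure lborel (A \<inter> {..a}) + d \<le> c"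
  shows "emeasure lborel A + d \<le> c"
proof -
  obtain t :: "nat \<Rightarrow> real" where t: "\<And>n. A \<inter> {..t n} = {} \<or> (\<exists>a\<in>A. t n \<le> a)" "incseq t" "AE x in lborel. x \<in> A \<longrightarrow> (\<exists>n. x \<le> t n)"
  proof (cases "A = {}")
    case False
    show ?thesis
    proof (cases "bdd_above A")
      case True
      define s where "s = Sup A"
      show ?thesis
      proof (rule that[of "\<lambda>n. s - 1 / real (Suc n)"])
        fix n
        have "s - 1 / real (Suc n) < s" by simp
        then show "A \<inter> {..s - 1 / real (Suc n)} = {} \<or> (\<exists>a\<in>A. s - 1 / real (Suc n) \<le> a)"
          unfolding s_def using less_cSup_iff[OF False True] less_imp_le by blast
      next
        show "incseq (\<lambda>n. s - 1 / real (Suc n))" by (auto simp: incseq_def field_simps)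
        have "AE x in lborel. x \<noteq> s" by (rule AE_lborel_singleton)
        then show "AE x in lborel. x \<in> A \<longrightarrow> (\<exists>n. x \<le> s - 1 / real (Suc n))"
        proof eventually_elim
          fix x assume "x \<noteq> s"
          show "x \<in> A \<longrightarrow> (\<exists>n. x \<le> s - 1 / real (Suc n))"
          proof
            assume "x \<in> A"
            then have "x \<le> s" unfolding s_def by (rule cSup_upper[OF _ True])
            with \<open>x \<noteq> s\<close> have "0 < s - x" by simp
            then obtain n where "inverse (real (Suc n)) < s - x" using reals_Archimedean by blast
            then show "\<exists>n. x \<le> s - 1 / real (Suc n)" by (intro exI[of _ n]) (simp add: inverse_eq_divide)
          qed
        qed
      qed
    next
      case unb: False
      show ?thesis
      proof (rule that[of real])
        show "A \<inter> {..real n} = {} \<or> (\<exists>a\<in>A. real n \<le> a)" for n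
          using unb unfolding bdd_above_def by (meson linear)
        show "AE x in lborel. x \<in> A \<longrightarrow> (\<exists>n. x \<le> real n)" by (simp add: real_arch_simple)
      qed (auto simp: incseq_def)
    qed
  qed (auto simp: that[of real] incseq_def)
  have le': "emeasure lborel (A \<inter> {..t n}) + d \<le> c" for n
  proof -
    obtain a where "a \<in> A" "A \<inter> {..t n} \<subseteq> A \<inter> {..a}" using t(1)[of n] ne by fastforce
    then show ?thesis by (intro order_trans[OF add_right_mono[OF emeasure_mono] le[of a]]) auto
  qed
  have "emeasure lborel A + d \<le> emeasure lborel (\<Union>n. A \<inter> {..t n}) + d"
    by (intro add_right_mono emeasure_mono_AE) (use t(3) in auto)
  also have "\<dots> = (SUP n. emeasure lborel (A \<inter> {..t n})) + d"
    by (subst SUP_emeasure_incseq[symmetric]) (use t(2) in \<open>auto simp: incseq_def intro: order_trans\<close>)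
  also have "\<dots> = (SUP n. emeasure lborel (A \<inter> {..t n}) + d)"
    by (simp add: ennreal_SUP_add_left)
  also have "\<dots> \<le> c" by (rule SUP_least) (rule le')
  finally show ?thesis .
qed

lemma emeasure_lborel_uminus:
  assumes [measurable]: "A \<in> sets borel" shows "emeasure lborel (uminus ` A) = emeasure lborel (A :: real set)"
proof -
  have e: "uminus ` A = uminus -` A \<inter> space lborel" by force
  have "emeasure lborel A = emeasure (distr lborel borel uminus) A" by (simp add: lborel_distr_uminus)
  also have "\<dots> = emeasure lborel (uminus ` A)" unfolding e by (subst emeasure_distr) auto
  finally show ?thesis by simp
qed

lemma emeasure_lborel_average:
  assumes [measurable]: "A \<in> sets borel"
  shows "(\<lambda>x::real. (x + b) / 2) ` A \<in> sets borel"
    "2 * emeasure lborel ((\<lambda>x. (x + b) / 2) ` A) = emeasure lborel A"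
proof -
  have e: "(\<lambda>x::real. (x + b) / 2) ` A = (\<lambda>x. 2 * x - b) -` A"
  proof safe
    fix x assume "2 * x - b \<in> A"
    then show "x \<in> (\<lambda>x. (x + b) / 2) ` A" by (rule rev_image_eqI) simp
  qed (auto simp: field_simps)
  show s: "(\<lambda>x::real. (x + b) / 2) ` A \<in> sets borel" unfolding e using measurable_sets_borel[of "\<lambda>x. 2 * x - b" borel A] by simp
  have "emeasure lborel A = (\<integral>\<^sup>+x. indicator A x \<partial>lborel)" by simp
  also have "\<dots> = ennreal \<bar>2\<bar> * (\<integral>\<^sup>+x. indicator A (- b + 2 * x) \<partial>lborel)"
    by (rule nn_integral_real_affine) auto
  also have "(\<integral>\<^sup>+x. indicator A (- b + 2 * x) \<partial>lborel) = (\<integral>\<^sup>+x. indicator ((\<lambda>x. (x + b) / 2) ` A) x \<partial>lborel)"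
    by (intro nn_integral_cong) (auto simp: e indicator_def)
  also have "\<dots> = emeasure lborel ((\<lambda>x. (x + b) / 2) ` A)" using s by simp
  finally show "2 * emeasure lborel ((\<lambda>x. (x + b) / 2) ` A) = emeasure lborel A" by simp
qed

text \<open>For \<open>a \<in> A\<close> and \<open>b \<in> B\<close>, the averages of \<open>A \<inter> {..a}\<close> with \<open>b\<close> and of \<open>a\<close> with \<open>B \<inter> {b..}\<close>
  lie on different sides of \<open>(a + b) / 2\<close>, so that their measures add up.\<close>

lemma brunn_minkowski_real:
  fixes A B C :: "real set"
  assumes [measurable]: "A \<in> sets borel" "B \<in> sets borel" "C \<in> sets borel"
    and ne: "A \<noteq> {}" "B \<noteq> {}" and C: "\<And>a b. a \<in> A \<Longrightarrow> b \<in> B \<Longrightarrow> (a + b) / 2 \<in> C"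
  shows "emeasure lborel A + emeasure lborel B \<le> 2 * emeasure lborel C"
proof -
  have main: "emeasure lborel (A \<inter> {..a}) + emeasure lborel (B \<inter> {b..}) \<le> 2 * emeasure lborel C"
    if a: "a \<in> A" and b: "b \<in> B" for a b
  proof -
    let ?A = "(\<lambda>x. (x + b) / 2) ` (A \<inter> {..a})" and ?B = "(\<lambda>x. (x + a) / 2) ` (B \<inter> {b..})"
    have sA: "?A \<in> sets lborel" and sB: "?B \<in> sets lborel" by (simp_all add: emeasure_lborel_average(1))
    have "?A \<inter> ?B \<subseteq> {(a+b)/2}" by auto
    then have z: "emeasure lborel (?A \<inter> ?B) = 0"
      by (metis emeasure_lborel_singleton emeasure_mono le_zero_eq sets_lborel sets.Int[OF sA sB] borel_singleton sets.empty_sets insert_is_Un)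
    have AEd: "AE x in lborel. \<not> (x \<in> ?A \<and> x \<in> ?B)"
      by (rule AE_I[of _ _ "?A \<inter> ?B"]) (use z sA sB in auto)
    have "emeasure lborel ?A + emeasure lborel ?B = (\<integral>\<^sup>+x. indicator ?A x + indicator ?B x \<partial>lborel)"
      using sA sB by (subst nn_integral_add) auto
    also have "\<dots> \<le> (\<integral>\<^sup>+x. indicator C x \<partial>lborel)"
    proof (rule nn_integral_mono_AE)
      show "AE x in lborel. indicator ?A x + indicator ?B x \<le> (indicator C x :: ennreal)"
        using AEd
      proof eventually_elim
        fix x assume n: "\<not> (x \<in> ?A \<and> x \<in> ?B)"
        have "x \<in> C" if "x \<in> ?A \<or> x \<in> ?B" using that C a b by (auto simp: add.commute) (metis add.commute)
        then show "indicator ?A x + indicator ?B x \<le> (indicator C x :: ennreal)" using n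
          by (auto simp: indicator_def simp del: Int_iff)
      qed
    qed
    also have "\<dots> = emeasure lborel C" by simp
    finally have "2 * (emeasure lborel ?A + emeasure lborel ?B) \<le> 2 * emeasure lborel C"
      by (rule mult_left_mono) simp
    then show ?thesis using emeasure_lborel_average(2)[of "A \<inter> {..a}" b] emeasure_lborel_average(2)[of "B \<inter> {b..}" a]
      by (simp add: distrib_left)
  qed
  have 1: "emeasure lborel A + emeasure lborel (B \<inter> {b..}) \<le> 2 * emeasure lborel C" if b: "b \<in> B" for b
    by (rule emeasure_lborel_add_le_Int_atMost) (use main[OF _ b] ne in auto)
  \<comment> \<open>Reflection turns the truncation \<open>B \<inter> {b..}\<close> into one from
    above, so that the same lemma removes it.\<close>
  have "emeasure lborel (uminus ` B) + emeasure lborel A \<le> 2 * emeasure lborel C"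
  proof (rule emeasure_lborel_add_le_Int_atMost)
    have "uminus ` B = uminus -` B" by force
    then show "uminus ` B \<in> sets borel" using measurable_sets_borel[of uminus borel B] by simp
    fix a assume "a \<in> uminus ` B"
    then obtain b where b: "b \<in> B" "a = - b" by auto
    have "uminus ` B \<inter> {..a} = uminus ` (B \<inter> {b..})" using b by force
    then have "emeasure lborel (uminus ` B \<inter> {..a}) = emeasure lborel (B \<inter> {b..})"
      by (simp add: emeasure_lborel_uminus)
    then show "emeasure lborel (uminus ` B \<inter> {..a}) + emeasure lborel A \<le> 2 * emeasure lborel C"
      using 1[OF b(1)] by (simp add: add.commute)
  qed (use ne in auto)
  then show ?thesis by (simp add: emeasure_lborel_uminus add.commute)
qed

section \<open>From level sets to the Prekopa--Leindler inequality\<close>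

lemma nn_integral_layer_cake:
  fixes f :: "real \<Rightarrow> real"
  assumes [measurable]: "f \<in> borel_measurable borel" and f: "\<And>x. 0 \<le> f x"
  shows "(\<integral>\<^sup>+x. ennreal (f x) \<partial>lborel) = (\<integral>\<^sup>+t. emeasure lborel {x. 0 \<le> t \<and> t < f x} \<partial>lborel)"
proof -
  have "(\<integral>\<^sup>+x. ennreal (f x) \<partial>lborel) = (\<integral>\<^sup>+x. \<integral>\<^sup>+t. indicator {0..<f x} t \<partial>lborel \<partial>lborel)"
    using f by (intro nn_integral_cong) simp
  also have "\<dots> = (\<integral>\<^sup>+x. \<integral>\<^sup>+t. indicator {(x,t). 0 \<le> t \<and> t < f x} (x,t) \<partial>lborel \<partial>lborel)"
    by (intro nn_integral_cong) (auto simp: indicator_def)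
  also have "\<dots> = (\<integral>\<^sup>+t. \<integral>\<^sup>+x. indicator {(x,t). 0 \<le> t \<and> t < f x} (x,t) \<partial>lborel \<partial>lborel)"
    by (rule lborel_pair.Fubini'[symmetric]) measurable
  also have "\<dots> = (\<integral>\<^sup>+t. emeasure lborel {x. 0 \<le> t \<and> t < f x} \<partial>lborel)"
  proof (rule nn_integral_cong)
    fix t :: real
    have "(\<integral>\<^sup>+x. indicator {(x,t). 0 \<le> t \<and> t < f x} (x,t) \<partial>lborel) = (\<integral>\<^sup>+x. indicator {x. 0 \<le> t \<and> t < f x} x \<partial>lborel)"
      by (intro nn_integral_cong) (simp add: indicator_def)
    also have "\<dots> = emeasure lborel {x. 0 \<le> t \<and> t < f x}" by (rule nn_integral_indicator) measurable
    finally show "(\<integral>\<^sup>+x. indicator {(x,t). 0 \<le> t \<and> t < f x} (x,t) \<partial>lborel) = \<dots>" .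
  qed
  finally show ?thesis .
qed

text \<open>Brunn--Minkowski needs nonempty sets. Since both suprema are 1, the level sets of
  \<open>f\<close> and \<open>g\<close> are nonempty for the same levels in \<open>[0, 1)\<close>,
  and averages of their points lie in the level set of \<open>h\<close>. Integrating over the levels
  gives the sum of the integrals.\<close>

lemma prekopa_leindler_sup_one:
  fixes f g h :: "real \<Rightarrow> real"
  assumes [measurable]: "f \<in> borel_measurable borel" "g \<in> borel_measurable borel" "h \<in> borel_measurable borel"
    and nn: "\<And>x. 0 \<le> f x" "\<And>x. 0 \<le> g x" "\<And>x. 0 \<le> h x"
    and f1: "\<And>x. f x \<le> 1" "\<And>t. t < 1 \<Longrightarrow> \<exists>x. t < f x"
    and g1: "\<And>x. g x \<le> 1" "\<And>t. t < 1 \<Longrightarrow> \<exists>x. t < g x"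
    and le: "\<And>x y. f x * g y \<le> (h ((x + y) / 2))\<^sup>2"
  shows "(\<integral>\<^sup>+x. f x \<partial>lborel) + (\<integral>\<^sup>+x. g x \<partial>lborel) \<le> 2 * (\<integral>\<^sup>+x. h x \<partial>lborel)"
proof -
  have "emeasure lborel {x. 0 \<le> t \<and> t < f x} + emeasure lborel {x. 0 \<le> t \<and> t < g x} \<le> 2 * emeasure lborel {x. 0 \<le> t \<and> t < h x}" for t
  proof (cases "0 \<le> t \<and> t < 1")
    case True
    show ?thesis
    proof (rule brunn_minkowski_real)
      show "{x. 0 \<le> t \<and> t < f x} \<noteq> {}" "{x. 0 \<le> t \<and> t < g x} \<noteq> {}" using f1(2) g1(2) True by auto
      fix a b assume a: "a \<in> {x. 0 \<le> t \<and> t < f x}" and b: "b \<in> {x. 0 \<le> t \<and> t < g x}"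
      have "t * t < f a * g b" using a b by (intro mult_strict_mono') auto
      also have "\<dots> \<le> (h ((a + b) / 2))\<^sup>2" by (rule le)
      finally have "t\<^sup>2 < (h ((a + b) / 2))\<^sup>2" by (simp add: power2_eq_square)
      then have "t < h ((a + b) / 2)" by (rule power2_less_imp_less) (rule nn)
      then show "(a + b) / 2 \<in> {x. 0 \<le> t \<and> t < h x}" using True by simp
    qed measurable
  next
    case False
    then have e: "{x. 0 \<le> t \<and> t < f x} = {}" "{x. 0 \<le> t \<and> t < g x} = {}"
      by (auto simp: not_less intro: order_trans[OF f1(1)] order_trans[OF g1(1)])
    show ?thesis unfolding e by simp
  qed
  then have "(\<integral>\<^sup>+t. emeasure lborel {x. 0 \<le> t \<and> t < f x} + emeasure lborel {x. 0 \<le> t \<and> t < g x} \<partial>lborel)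
       \<le> (\<integral>\<^sup>+t. 2 * emeasure lborel {x. 0 \<le> t \<and> t < h x} \<partial>lborel)"
    by (intro nn_integral_mono)
  also have "\<dots> = 2 * (\<integral>\<^sup>+x. h x \<partial>lborel)"
    by (subst nn_integral_cmult) (auto simp: nn_integral_layer_cake nn)
  finally show ?thesis
    by (subst (asm) nn_integral_add) (auto simp: nn_integral_layer_cake nn)
qed

text \<open>Divide \<open>f\<close> and \<open>g\<close> by their suprema \<open>a\<close> and
  \<open>b\<close>, and \<open>h\<close> by \<open>sqrt (a * b)\<close>, which preserves the
  hypothesis. The additive inequality then becomes the multiplicative one by the inequality of
  arithmetic and geometric means.\<close>

lemma prekopa_leindler_real:
  fixes f g h :: "real \<Rightarrow> real"
  assumes int: "integrable lborel f" "integrable lborel g" "integrable lborel h"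
    and nn: "\<And>x. 0 \<le> f x" "\<And>x. 0 \<le> g x" "\<And>x. 0 \<le> h x"
    and B: "\<And>x. f x \<le> B" "\<And>x. g x \<le> B"
    and le: "\<And>x y. f x * g y \<le> (h ((x + y) / 2))\<^sup>2"
  shows "(LINT x|lborel. f x) * (LINT x|lborel. g x) \<le> (LINT x|lborel. h x)\<^sup>2"
proof (cases "(\<forall>x. f x = 0) \<or> (\<forall>x. g x = 0)")
  case True
  then have "f = (\<lambda>_. 0) \<or> g = (\<lambda>_. 0)" by auto
  then have "(LINT x|lborel. f x) * (LINT x|lborel. g x) = 0" by auto
  then show ?thesis by (metis zero_le_power2)
next
  case False
  then obtain x0 y0 where "f x0 \<noteq> 0" "g y0 \<noteq> 0" by auto
  with nn have pos: "0 < f x0" "0 < g y0" by (simp_all add: order_less_le)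
  have [measurable]: "f \<in> borel_measurable borel" "g \<in> borel_measurable borel" "h \<in> borel_measurable borel"
    using int by (auto dest: borel_measurable_integrable)
  define a b where "a = Sup (range f)" and "b = Sup (range g)"
  have bf: "bdd_above (range f)" "bdd_above (range g)" using B by (auto intro!: bdd_aboveI)
  have fa: "f x \<le> a" and gb: "g x \<le> b" for x unfolding a_def b_def using bf by (auto intro!: cSup_upper)
  have a: "a > 0" and b: "b > 0" using pos fa[of x0] gb[of y0] by auto
  define c where "c = sqrt (a * b)"
  have c: "c > 0" "c\<^sup>2 = a * b" using a b by (simp_all add: c_def)
  have "(\<integral>\<^sup>+x. f x / a \<partial>lborel) + (\<integral>\<^sup>+x. g x / b \<partial>lborel) \<le> 2 * (\<integral>\<^sup>+x. h x / c \<partial>lborel)"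
  proof (rule prekopa_leindler_sup_one)
    show "f x / a \<le> 1" "g x / b \<le> 1" for x using a b fa gb by auto
    show "\<exists>x. t < f x / a" if "t < 1" for t
    proof -
      have "t * a < Sup (range f)" using that a by (simp add: a_def[symmetric])
      then show ?thesis using a less_cSup_iff[OF _ bf(1), of "t * a"] by (auto simp: field_simps)
    qed
    show "\<exists>x. t < g x / b" if "t < 1" for t
    proof -
      have "t * b < Sup (range g)" using that b by (simp add: b_def[symmetric])
      then show ?thesis using b less_cSup_iff[OF _ bf(2), of "t * b"] by (auto simp: field_simps)
    qed
    show "f x / a * (g y / b) \<le> (h ((x + y) / 2) / c)\<^sup>2" for x y
      using divide_right_mono[OF le[of x y], of "a * b"] a b by (simp add: power_divide c(2))
  qed (use nn a b c in auto)
  moreover have "(\<integral>\<^sup>+x. f x / a \<partial>lborel) = ennreal ((LINT x|lborel. f x) / a)"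
    "(\<integral>\<^sup>+x. g x / b \<partial>lborel) = ennreal ((LINT x|lborel. g x) / b)"
    "(\<integral>\<^sup>+x. h x / c \<partial>lborel) = ennreal ((LINT x|lborel. h x) / c)"
    using nn a b c int by (subst nn_integral_eq_integral; simp)+
  moreover define F G H where "F = (LINT x|lborel. f x)" and "G = (LINT x|lborel. g x)" and "H = (LINT x|lborel. h x)"
  moreover have FGH: "0 \<le> F" "0 \<le> G" "0 \<le> H" using nn by (simp_all add: F_def G_def H_def)
  moreover have "ennreal (F / a + G / b) = ennreal (F / a) + ennreal (G / b)"
    using FGH a b by (intro ennreal_plus) auto
  moreover have "ennreal (2 * (H / c)) = 2 * ennreal (H / c)"
    using FGH c by (subst ennreal_mult) auto
  ultimately have "ennreal (F / a + G / b) \<le> ennreal (2 * (H / c))"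
    by simp
  then have *: "F / a + G / b \<le> 2 * (H / c)" using FGH c by (simp add: ennreal_le_iff)
  have am_gm: "4 * (u * v) \<le> (u + v)\<^sup>2" for u v :: real
    using zero_le_power2[of "u - v"] by (simp add: power2_eq_square algebra_simps)
  have "4 * ((F / a) * (G / b)) \<le> (F / a + G / b)\<^sup>2"
    using am_gm .
  also have "\<dots> \<le> (2 * (H / c))\<^sup>2" using * FGH a b by (intro power_mono) auto
  finally have "F * G / (a * b) \<le> H\<^sup>2 / (a * b)" by (simp add: power_mult_distrib power_divide c(2))
  then have "F * G \<le> H\<^sup>2" using a b by (simp add: divide_le_cancel)
  then show ?thesis by (simp add: F_def G_def H_def)
qed

text \<open>The normal density is log-concave: it satisfies the midpoint hypothesis itself and can
  be absorbed into all three functions.\<close>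

lemma prekopa_leindler_centered_normal:
  fixes f g h :: "real \<Rightarrow> real"
  assumes v: "v > 0" and [measurable]: "f \<in> borel_measurable borel" "g \<in> borel_measurable borel" "h \<in> borel_measurable borel"
    and f: "\<And>x. 0 \<le> f x" "\<And>x. f x \<le> 1"
    and g: "\<And>x. 0 \<le> g x" "\<And>x. g x \<le> 1"
    and h: "\<And>x. 0 \<le> h x" "\<And>x. h x \<le> 1"
    and le: "\<And>x y. f x * g y \<le> (h ((x + y) / 2))\<^sup>2"
  shows "(LINT x|centered_normal v. f x) * (LINT x|centered_normal v. g x) \<le> (LINT x|centered_normal v. h x)\<^sup>2"
proof -
  let ?n = "normal_density 0 (sqrt v)"
  have n: "?n x * ?n y \<le> (?n ((x + y) / 2))\<^sup>2" for x y
  proof -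
    have "- x\<^sup>2 / (2 * v) + - y\<^sup>2 / (2 * v) \<le> 2 * (- ((x + y) / 2)\<^sup>2 / (2 * v))"
    proof -
      have "((x + y) / 2)\<^sup>2 * 2 \<le> x\<^sup>2 + y\<^sup>2"
        using zero_le_power2[of "x - y"] by (simp add: power2_eq_square algebra_simps)
      then have "((x + y) / 2)\<^sup>2 * 2 / (2 * v) \<le> (x\<^sup>2 + y\<^sup>2) / (2 * v)"
        by (rule divide_right_mono) (use v in simp)
      then show ?thesis by (simp add: add_divide_distrib)
    qed
    then have "exp (- x\<^sup>2 / (2 * v)) * exp (- y\<^sup>2 / (2 * v)) \<le> (exp (- ((x + y) / 2)\<^sup>2 / (2 * v)))\<^sup>2"
      by (simp add: exp_add[symmetric] exp_double[symmetric])
    then have "(1 / sqrt (2 * pi * v))\<^sup>2 * (exp (- x\<^sup>2 / (2 * v)) * exp (- y\<^sup>2 / (2 * v))) \<le>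
      (1 / sqrt (2 * pi * v))\<^sup>2 * (exp (- ((x + y) / 2)\<^sup>2 / (2 * v)))\<^sup>2"
      by (rule mult_left_mono) simp
    then show ?thesis using v by (simp add: normal_density_def power_mult_distrib power2_eq_square mult_ac)
  qed
  have i: "integrable lborel (\<lambda>x. ?n x * k x)" if "\<And>x. 0 \<le> k x" "\<And>x. k x \<le> 1" "k \<in> borel_measurable borel" for k :: "real \<Rightarrow> real"
    by (rule Bochner_Integration.integrable_bound[of _ ?n]) (use v that in \<open>auto simp: abs_mult mult_left_le\<close>)
  have bound: "?n x * k x \<le> 1 / sqrt (2 * pi * v)" if "k x \<le> 1" "0 \<le> k x" for k :: "real \<Rightarrow> real" and x
  proof -
    have "?n x \<le> 1 / sqrt (2 * pi * v)" using v by (auto simp: normal_density_def intro!: mult_left_le divide_right_mono)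
    moreover have "?n x * k x \<le> ?n x" using that by (simp add: mult_left_le)
    ultimately show ?thesis by linarith
  qed
  have "(LINT x|lborel. ?n x * f x) * (LINT x|lborel. ?n x * g x) \<le> (LINT x|lborel. ?n x * h x)\<^sup>2"
  proof (rule prekopa_leindler_real[where B="1 / sqrt (2 * pi * v)"])
    fix x y
    have "(?n x * f x) * (?n y * g y) = (?n x * ?n y) * (f x * g y)" by simp
    also have "\<dots> \<le> (?n ((x + y) / 2))\<^sup>2 * (h ((x + y) / 2))\<^sup>2"
      using f g by (intro mult_mono n le) auto
    finally show "(?n x * f x) * (?n y * g y) \<le> (?n ((x + y) / 2) * h ((x + y) / 2))\<^sup>2"
      by (simp add: power_mult_distrib)
  qed (use i f g h bound in auto)
  then show ?thesis unfolding centered_normal_def by (simp add: integral_density)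
qed

section \<open>Anderson's inequality\<close>

context nondegenerate_gaussian
begin

lemma prob_UNIV [simp]: "prob UNIV = 1"
  using prob_space by simp

text \<open>Resampling one direction after the other reduces the number of functionals on which the
  integrands depend, and each step only needs the one-dimensional inequality.\<close>

lemma prekopa_leindler:
  fixes f g h :: "'a \<Rightarrow> real"
  assumes "finite D" and [measurable]: "f \<in> borel_measurable borel" "g \<in> borel_measurable borel" "h \<in> borel_measurable borel"
    and f: "\<And>x. 0 \<le> f x" "\<And>x. f x \<le> 1" "\<And>x y. (\<forall>d\<in>D. x \<bullet> d = y \<bullet> d) \<Longrightarrow> f x = f y"
    and g: "\<And>x. 0 \<le> g x" "\<And>x. g x \<le> 1" "\<And>x y. (\<forall>d\<in>D. x \<bullet> d = y \<bullet> d) \<Longrightarrow> g x = g y"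
    and h: "\<And>x. 0 \<le> h x" "\<And>x. h x \<le> 1" "\<And>x y. (\<forall>d\<in>D. x \<bullet> d = y \<bullet> d) \<Longrightarrow> h x = h y"
    and le: "\<And>x y. f x * g y \<le> (h ((1/2) *\<^sub>R (x + y)))\<^sup>2"
  shows "(LINT x|M. f x) * (LINT x|M. g x) \<le> (LINT x|M. h x)\<^sup>2"
  using assms
proof (induction "card D" arbitrary: D f g h rule: less_induct)
  case less
  note [measurable] = less.prems(2-4)
  show ?case
  proof (cases "D \<subseteq> {0}")
    case True
    then have "\<forall>d\<in>D. x \<bullet> d = 0 \<bullet> d" for x by auto
    then have c: "f x = f 0" "g x = g 0" "h x = h 0" for x
      by (blast intro: less.prems(7) less.prems(10) less.prems(13))+
    have const: "(LINT x|M. F x) = F 0" if "\<And>x. F x = F 0" for F :: "'a \<Rightarrow> real"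
    proof -
      have "F = (\<lambda>_. F 0)" using that by auto
      then have "(LINT x|M. F x) = (LINT x|M. F 0)" by metis
      then show ?thesis by (simp add: prob_UNIV)
    qed
    have "(LINT x|M. f x) = f 0" "(LINT x|M. g x) = g 0" "(LINT x|M. h x) = h 0"
      by (rule const, rule c)+
    then show ?thesis using less.prems(14)[of 0 0] by simp
  next
    case False
    then obtain k where k: "k \<in> D" "k \<noteq> 0" by auto
    let ?N = "centered_normal (Q k)"
    have q: "Q k > 0" using Q_pos[OF k(2)] .
    interpret N: prob_space ?N by (rule prob_space_centered_normal[OF q])
    define avg where "avg F x = (LINT y|?N. F (recombine k x y))" for F :: "'a \<Rightarrow> real" and x
    \<comment> \<open>By \<open>recombine_inner\<close> the averages depend on \<open>x\<close> only
      through these functionals. The one for \<open>k\<close> would be 0; leaving it out makes the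
      cardinality drop.\<close>
    define E where "E = (\<lambda>d. d - (dir k \<bullet> d) *\<^sub>R k) ` (D - {k})"
    have "finite E" "card E < card D"
      using less.prems(1) k(1) unfolding E_def
      by (auto intro!: le_less_trans[OF card_image_le] card_Diff1_less)
    have dk: "dir k \<bullet> k = 1" using q by (simp add: dir_def Q_def)
    have A: "avg F \<in> borel_measurable borel \<and> (\<forall>x. 0 \<le> avg F x \<and> avg F x \<le> 1) \<and>
        (\<forall>x y. (\<forall>d\<in>E. x \<bullet> d = y \<bullet> d) \<longrightarrow> avg F x = avg F y) \<and> (LINT x|M. F x) = (LINT x|M. avg F x)"
      if [measurable]: "F \<in> borel_measurable borel" and F: "\<And>x. 0 \<le> F x" "\<And>x. F x \<le> 1" "\<And>x y. (\<forall>d\<in>D. x \<bullet> d = y \<bullet> d) \<Longrightarrow> F x = F y"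
      for F :: "'a \<Rightarrow> real"
    proof (intro conjI allI impI)
      show "avg F \<in> borel_measurable borel" unfolding avg_def by measurable
      fix x y
      show "0 \<le> avg F x" unfolding avg_def using F by simp
      have "avg F x \<le> (LINT y|?N. 1)" unfolding avg_def
        by (rule integral_mono[OF N.integrable_const_bound[of _ 1]]) (use F in auto)
      then show "avg F x \<le> 1" by (simp add: N.prob_space)
      show "(LINT x|M. F x) = (LINT x|M. avg F x)" unfolding avg_def
        by (rule integral_recombine[OF k(2), where B=1]) (use F in auto)
      assume e: "\<forall>d\<in>E. x \<bullet> d = y \<bullet> d"
      show "avg F x = avg F y" unfolding avg_def
      proof (intro Bochner_Integration.integral_cong refl F(3) ballI)
        fix t d assume "d \<in> D"
        show "recombine k x t \<bullet> d = recombine k y t \<bullet> d"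
        proof (cases "d = k")
          case False
          then show ?thesis using e \<open>d \<in> D\<close> unfolding recombine_inner E_def by simp
        qed (simp add: recombine_inner dk)
      qed
    qed
    note Af = A[OF less.prems(2,5,6,7)] and Ag = A[OF less.prems(3,8,9,10)] and Ah = A[OF less.prems(4,11,12,13)]
    have "(LINT x|M. avg f x) * (LINT x|M. avg g x) \<le> (LINT x|M. avg h x)\<^sup>2"
    proof (rule less.hyps[OF \<open>card E < card D\<close> \<open>finite E\<close>])
      fix x y
      show "avg f x * avg g y \<le> (avg h ((1/2) *\<^sub>R (x + y)))\<^sup>2"
        unfolding avg_def
      proof (rule prekopa_leindler_centered_normal[OF q])
        fix s t
        have "recombine k ((1/2) *\<^sub>R (x + y)) ((s + t) / 2) = (1/2) *\<^sub>R (recombine k x s + recombine k y t)"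
          by (simp add: recombine_def inner_add_left add_divide_distrib algebra_simps)
        then show "f (recombine k x s) * g (recombine k y t) \<le> (h (recombine k ((1/2) *\<^sub>R (x + y)) ((s + t) / 2)))\<^sup>2"
          using less.prems(14) by simp
      qed (use less.prems in auto)
    qed (use Af Ag Ah in blast)+
    then show ?thesis using Af Ag Ah by simp
  qed
qed

text \<open>Apply Prekopa--Leindler to the indicators of the sets centred at \<open>a\<close>,
  \<open>- a\<close> and 0: midpoints of the first two lie in the third. Symmetry of
  \<open>M\<close> makes the first two measures equal, so squares are compared.\<close>

lemma anderson_slabs:
  assumes "finite F"
  shows "measure M {x. \<forall>(d,r)\<in>F. \<bar>(x - a) \<bullet> d\<bar> \<le> r} \<le> measure M {x. \<forall>(d,r)\<in>F. \<bar>x \<bullet> d\<bar> \<le> r}"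
proof -
  define C where "C a = {x. \<forall>(d,r)\<in>F. \<bar>(x - a) \<bullet> d\<bar> \<le> r}" for a :: 'a
  have C[measurable]: "C a \<in> sets borel" for a
  proof -
    have "C a = (\<Inter>(d,r)\<in>F. {x. \<bar>(x - a) \<bullet> d\<bar> \<le> r})" by (auto simp: C_def)
    moreover have "closed \<dots>" by (intro closed_INT ballI) (auto intro!: closed_Collect_le continuous_intros)
    ultimately show ?thesis by simp
  qed
  have dep: "indicator (C b) x = (indicator (C b) y :: real)" if "\<forall>d\<in>fst ` F. x \<bullet> d = y \<bullet> d" for b x y
  proof -
    have "\<bar>(x - b) \<bullet> d\<bar> \<le> r \<longleftrightarrow> \<bar>(y - b) \<bullet> d\<bar> \<le> r" if "(d,r) \<in> F" for d r
      using \<open>\<forall>d\<in>fst ` F. x \<bullet> d = y \<bullet> d\<close> that by (force simp: inner_diff_left)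
    then have "x \<in> C b \<longleftrightarrow> y \<in> C b"
      unfolding C_def mem_Collect_eq by (intro ball_cong refl) auto
    then show ?thesis by (simp add: indicator_def)
  qed
  have "(LINT x|M. indicator (C a) x) * (LINT x|M. indicator (C (- a)) x) \<le> (LINT x|M. indicator (C 0) x :: real)\<^sup>2"
  proof (rule prekopa_leindler[of "fst ` F"])
    fix x y
    have "(1/2) *\<^sub>R (x + y) \<in> C 0" if "x \<in> C a" "y \<in> C (- a)"
      unfolding C_def
    proof safe
      fix d r assume "(d,r) \<in> F"
      then have "\<bar>(x - a) \<bullet> d\<bar> \<le> r" "\<bar>(y + a) \<bullet> d\<bar> \<le> r" using that by (auto simp: C_def)
      then show "\<bar>((1/2) *\<^sub>R (x + y) - 0) \<bullet> d\<bar> \<le> r" by (simp add: inner_add_left inner_diff_left)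
    qed
    then show "indicator (C a) x * indicator (C (- a)) y \<le> (indicator (C 0) ((1/2) *\<^sub>R (x + y)) :: real)\<^sup>2"
      by (auto simp: indicator_def)
  qed (use assms dep in auto)
  then have "measure M (C a) * measure M (C (- a)) \<le> (measure M (C 0))\<^sup>2" by simp
  moreover have "measure M (C (- a)) = measure M (C a)"
  proof -
    have e: "\<bar>(- x - a) \<bullet> d\<bar> = \<bar>(x - - a) \<bullet> d\<bar>" for x d
      by (simp add: inner_diff_left inner_add_left)
    have "uminus -` C a = C (- a)"
      unfolding C_def vimage_def mem_Collect_eq e ..
    then show ?thesis using measure_distr[of uminus M borel "C a"] by (simp add: distr_uminus)
  qed
  ultimately have "(measure M (C a))\<^sup>2 \<le> (measure M (C 0))\<^sup>2" by (simp add: power2_eq_square)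
  then have "measure M (C a) \<le> measure M (C 0)" by (rule power2_le_imp_le) simp
  then show ?thesis by (simp add: C_def)
qed

text \<open>A closed ball is the decreasing limit of intersections of finitely many slabs, with
  directions from a dense sequence.\<close>

lemma anderson_cball: "measure M (cball a e) \<le> measure M (cball 0 e)"
proof (cases "0 \<le> e")
  case True
  obtain d :: "nat \<Rightarrow> 'a" where d: "\<And>X. open X \<Longrightarrow> X \<noteq> {} \<Longrightarrow> \<exists>n. d n \<in> X"
    using dense_countable_enum by blast
  define C where "C a n = {x. \<forall>(d,r)\<in>(\<lambda>i. (d i, e * norm (d i))) ` {..<n}. \<bar>(x - a) \<bullet> d\<bar> \<le> r}" for a :: 'a and n
  have cb: "cball a e = (\<Inter>n. C a n)" for a
  proof
    show "cball a e \<subseteq> (\<Inter>n. C a n)"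
    proof (clarsimp simp: C_def dist_norm norm_minus_commute)
      fix x i assume "norm (x - a) \<le> e"
      then show "\<bar>(x - a) \<bullet> d i\<bar> \<le> e * norm (d i)"
        using Cauchy_Schwarz_ineq2[of "x - a" "d i"] mult_right_mono[of "norm (x - a)" e "norm (d i)"] by simp
    qed
    show "(\<Inter>n. C a n) \<subseteq> cball a e"
    proof
      fix x assume "x \<in> (\<Inter>n. C a n)"
      then have "x \<in> C a (Suc n)" for n by blast
      then have "\<bar>(x - a) \<bullet> d n\<bar> \<le> e * norm (d n)" for n by (auto simp: C_def)
      then have "norm (x - a) \<le> e" using norm_le_iff_dense[OF d, of "x - a" e] True by (auto simp: abs_le_iff)
      then show "x \<in> cball a e" by (simp add: dist_norm norm_minus_commute)
    qed
  qed
  have Cm: "C a n \<in> sets M" for a n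
  proof -
    have "C a n = (\<Inter>i\<in>{..<n}. {x. \<bar>(x - a) \<bullet> d i\<bar> \<le> e * norm (d i)})" by (auto simp: C_def)
    moreover have "closed \<dots>" by (intro closed_INT ballI) (auto intro!: closed_Collect_le continuous_intros)
    ultimately show ?thesis by simp
  qed
  have lim: "(\<lambda>n. measure M (C a n)) \<longlonglongrightarrow> measure M (cball a e)" for a
    unfolding cb by (rule finite_Lim_measure_decseq) (use Cm in \<open>auto simp: decseq_def C_def\<close>)
  show ?thesis
  proof (rule LIMSEQ_le[OF lim lim], intro exI allI impI)
    fix n show "measure M (C a n) \<le> measure M (C 0 n)"
      unfolding C_def using anderson_slabs[of "(\<lambda>i. (d i, e * norm (d i))) ` {..<n}" a] by simp
  qed
qed simp

lemma ball_limit: "(\<lambda>n. measure M (cball a (e - 1 / Suc n))) \<longlonglongrightarrow> measure M (ball a e)"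
proof -
  have "ball a e = (\<Union>n. cball a (e - 1 / Suc n))"
  proof safe
    fix x assume "x \<in> ball a e"
    then have "0 < e - dist a x" by simp
    then obtain n where "inverse (real (Suc n)) < e - dist a x" using reals_Archimedean by blast
    then have "x \<in> cball a (e - 1 / Suc n)" by (simp add: inverse_eq_divide)
    then show "x \<in> (\<Union>n. cball a (e - 1 / Suc n))" by blast
  next
    fix x n assume "x \<in> cball a (e - 1 / Suc n)"
    moreover have "0 < 1 / real (Suc n)" by simp
    ultimately show "x \<in> ball a e" unfolding mem_ball mem_cball by linarith
  qed
  moreover have "range (\<lambda>n. cball a (e - 1 / Suc n)) \<subseteq> sets M" by auto
  moreover have "incseq (\<lambda>n. cball a (e - 1 / Suc n))"
    unfolding incseq_def
  proof (intro allI impI subset_cball diff_left_mono)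
    fix m n :: nat assume "m \<le> n"
    then show "1 / real (Suc n) \<le> 1 / real (Suc m)" by (simp add: frac_le)
  qed
  ultimately show ?thesis using finite_Lim_measure_incseq[of "\<lambda>n. cball a (e - 1 / Suc n)"] by simp
qed

lemma anderson: "measure M (ball a e) \<le> measure M (ball 0 e)"
  by (rule LIMSEQ_le[OF ball_limit ball_limit]) (auto intro: anderson_cball)

text \<open>Were the centred ball null, all balls of that radius would be null by Anderson, and by
  separability countably many of them cover the space.\<close>

lemma measure_ball_pos: assumes "e > 0" shows "0 < measure M (ball 0 e)"
proof (rule ccontr)
  assume "\<not> ?thesis"
  then have z: "measure M (ball a e) = 0" for a
    using anderson[of a e] measure_nonneg[of M "ball a e"] measure_nonneg[of M "ball 0 e"] by linarith
  obtain d :: "nat \<Rightarrow> 'a" where d: "\<And>X. open X \<Longrightarrow> X \<noteq> {} \<Longrightarrow> \<exists>n. d n \<in> X"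
    using dense_countable_enum by blast
  have U: "(\<Union>n. ball (d n) e) = UNIV"
  proof safe
    fix x
    obtain n where "d n \<in> ball x e" using d[of "ball x e"] assms by auto
    then show "x \<in> (\<Union>n. ball (d n) e)" by (auto simp: dist_commute)
  qed simp
  have "(\<Union>n. ball (d n) e) \<in> null_sets M"
    using z by (intro null_sets_UN) (auto simp: null_sets_def emeasure_eq_measure)
  then show False using prob_space unfolding U by (auto simp: null_sets_def emeasure_eq_measure)
qed

end

section \<open>Small balls, energy and equivalent shifts\<close>

text \<open>Only null sets enter, so two measures with the same null sets, such as prior and
  posterior, have the same equivalent shifts.\<close>

lemma equivalent_shifts_iff:
  fixes M :: "'a::{real_inner, polish_space} measure"
  assumes [measurable_cong]: "sets M = sets borel"
  shows "h \<in> equivalent_shifts M \<longleftrightarrow> (\<forall>A\<in>sets borel. {x. x + h \<in> A} \<in> null_sets M \<longleftrightarrow> A \<in> null_sets M)"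
proof -
  have sp: "space M = UNIV" using sets_eq_imp_space_eq[OF assms] by simp
  have "A \<in> null_sets (shifted_measure M h) \<longleftrightarrow> {x. x + h \<in> A} \<in> null_sets M \<and> A \<in> sets borel" for A
    unfolding shifted_measure_def by (subst null_sets_distr_iff) (auto simp: sp vimage_def)
  then show ?thesis
    unfolding equivalent_shifts_def equivalent_measures_def absolutely_continuous_def
    using assms null_sets_def[of M] by (auto 0 3)
qed

section \<open>Ball estimates from the Cameron--Martin formula\<close>

context nondegenerate_gaussian
begin

lemma emeasure_shift:
  assumes [measurable]: "A \<in> sets borel"
  shows "emeasure M {x. x + S k \<in> A} = (\<integral>\<^sup>+x. indicator A x * ennreal (exp (x \<bullet> k - Q k / 2)) \<partial>M)"
proof -
  have "emeasure M {x. x + S k \<in> A} = (\<integral>\<^sup>+x. indicator {x. x + S k \<in> A} x \<partial>M)"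
    by (subst nn_integral_indicator) auto
  also have "\<dots> = (\<integral>\<^sup>+x. indicator A (x + S k) \<partial>M)"
    by (intro nn_integral_cong) (simp add: indicator_def)
  finally show ?thesis by (simp add: cameron_martin)
qed

text \<open>Translate the ball by \<open>- S k\<close>. On the translated ball the density exceeds
  its value at the centre at most by the factor \<open>exp (e * norm k)\<close>, and Anderson's
  inequality moves the centre to 0.\<close>

lemma measure_ball_le:
  "measure M (ball z e) \<le> exp (- (z \<bullet> k - Q k / 2) + e * norm k) * measure M (ball 0 e)"
proof -
  have b: "ball z e = {x. x + S (- k) \<in> ball (z - S k) e}" by (auto simp: S_simps dist_norm)
  have "emeasure M (ball z e) = (\<integral>\<^sup>+x. indicator (ball (z - S k) e) x * ennreal (exp (x \<bullet> (- k) - Q (- k) / 2)) \<partial>M)"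
    by (subst b, subst emeasure_shift) simp_all
  also have "\<dots> \<le> (\<integral>\<^sup>+x. ennreal (exp (- (z \<bullet> k - Q k / 2) + e * norm k)) * indicator (ball (z - S k) e) x \<partial>M)"
  proof (rule nn_integral_mono)
    fix x
    have "x \<bullet> (- k) - Q (- k) / 2 \<le> - (z \<bullet> k - Q k / 2) + e * norm k" if "x \<in> ball (z - S k) e"
    proof -
      have "(z - S k - x) \<bullet> k \<le> norm (z - S k - x) * norm k" by (rule norm_cauchy_schwarz)
      also have "\<dots> \<le> e * norm k" using that by (intro mult_right_mono) (auto simp: dist_norm)
      finally show ?thesis by (simp add: inner_diff_left Q_simps Q_def[of k, symmetric])
    qed
    then show "indicator (ball (z - S k) e) x * ennreal (exp (x \<bullet> (- k) - Q (- k) / 2)) \<le>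
      ennreal (exp (- (z \<bullet> k - Q k / 2) + e * norm k)) * indicator (ball (z - S k) e) x"
      by (auto simp: indicator_def simp del: mem_ball)
  qed
  also have "\<dots> = ennreal (exp (- (z \<bullet> k - Q k / 2) + e * norm k)) * emeasure M (ball (z - S k) e)"
    by (rule nn_integral_cmult_indicator) simp
  finally have "measure M (ball z e) \<le> exp (- (z \<bullet> k - Q k / 2) + e * norm k) * measure M (ball (z - S k) e)"
    by (simp add: emeasure_eq_measure ennreal_mult[symmetric])
  also have "\<dots> \<le> exp (- (z \<bullet> k - Q k / 2) + e * norm k) * measure M (ball 0 e)"
    by (intro mult_left_mono anderson) simp
  finally show ?thesis .
qed

text \<open>By symmetry the density \<open>exp (- x \<bullet> k)\<close> may be replaced by \<open>cosh (x \<bullet> k) \<ge> 1\<close>.\<close>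

lemma measure_ball_S_ge: "exp (- Q k / 2) * measure M (ball 0 e) \<le> measure M (ball (S k) e)"
proof -
  have [measurable]: "ball (0::'a) e \<in> sets borel" by simp
  have b: "ball (S j) e = {x. x + S (- j) \<in> ball 0 e}" for j by (auto simp: S_simps dist_norm norm_minus_commute)
  have e: "emeasure M (ball (S j) e) = (\<integral>\<^sup>+x. indicator (ball 0 e) x * ennreal (exp (x \<bullet> (- j) - Q (- j) / 2)) \<partial>M)" for j
    by (subst b, subst emeasure_shift) simp_all
  have "ball (S k) e = uminus -` ball (S (- k)) e"
    by (auto simp: S_simps dist_norm norm_minus_commute add.commute)
  then have sym: "emeasure M (ball (S (- k)) e) = emeasure M (ball (S k) e)"
    using emeasure_distr[of uminus M borel "ball (S (- k)) e"] by (simp add: distr_uminus)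
  have "2 * (ennreal (exp (- Q k / 2)) * emeasure M (ball 0 e)) = (\<integral>\<^sup>+x. 2 * ennreal (exp (- Q k / 2)) * indicator (ball 0 e) x \<partial>M)"
    by (subst nn_integral_cmult_indicator) (auto simp: mult.assoc)
  also have "\<dots> \<le> (\<integral>\<^sup>+x. indicator (ball 0 e) x * ennreal (exp (x \<bullet> (- k) - Q (- k) / 2)) +
      indicator (ball 0 e) x * ennreal (exp (x \<bullet> (- (- k)) - Q (- (- k)) / 2)) \<partial>M)"
  proof (rule nn_integral_mono)
    fix x
    have "2 \<le> exp (- (x \<bullet> k)) + exp (x \<bullet> k)"
      using exp_ge_add_one_self[of "- (x \<bullet> k)"] exp_ge_add_one_self[of "x \<bullet> k"] by linarith
    then have "2 * exp (- Q k / 2) \<le> (exp (- (x \<bullet> k)) + exp (x \<bullet> k)) * exp (- Q k / 2)"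
      by (rule mult_right_mono) simp
    then have "ennreal (2 * exp (- Q k / 2)) \<le> ennreal (exp (- (x \<bullet> k) - Q k / 2) + exp (x \<bullet> k - Q k / 2))"
      by (intro ennreal_leI) (simp add: distrib_right exp_add[symmetric])
    then have "2 * ennreal (exp (- Q k / 2)) \<le> ennreal (exp (- (x \<bullet> k) - Q k / 2)) + ennreal (exp (x \<bullet> k - Q k / 2))"
      by (simp add: ennreal_mult)
    then show "2 * ennreal (exp (- Q k / 2)) * indicator (ball 0 e) x \<le>
      indicator (ball 0 e) x * ennreal (exp (x \<bullet> (- k) - Q (- k) / 2)) +
      indicator (ball 0 e) x * ennreal (exp (x \<bullet> (- (- k)) - Q (- (- k)) / 2))"
      by (simp add: indicator_def Q_simps)
  qed
  also have "\<dots> = emeasure M (ball (S k) e) + emeasure M (ball (S (- k)) e)"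
    unfolding e by (rule nn_integral_add) measurable
  also have "\<dots> = 2 * emeasure M (ball (S k) e)" by (simp add: sym mult_2)
  finally have "ennreal (2 * (exp (- Q k / 2) * measure M (ball 0 e))) \<le> ennreal (2 * measure M (ball (S k) e))"
    by (simp add: emeasure_eq_measure ennreal_mult)
  then show ?thesis by (simp add: ennreal_le_iff)
qed

text \<open>The Cameron--Martin density has total mass 1.\<close>

lemma nn_integral_exp_inner: "(\<integral>\<^sup>+x. ennreal (exp (x \<bullet> k)) \<partial>M) = ennreal (exp (Q k / 2))"
proof -
  have "1 = emeasure M {x. x + S k \<in> UNIV}" by (simp add: emeasure_eq_measure)
  also have "\<dots> = (\<integral>\<^sup>+x. ennreal (exp (- Q k / 2)) * ennreal (exp (x \<bullet> k)) \<partial>M)"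
    by (subst emeasure_shift) (auto simp: ennreal_mult[symmetric] exp_add[symmetric])
  also have "\<dots> = ennreal (exp (- Q k / 2)) * (\<integral>\<^sup>+x. ennreal (exp (x \<bullet> k)) \<partial>M)"
    by (rule nn_integral_cmult) simp
  finally have "ennreal (exp (Q k / 2)) * 1 = ennreal (exp (Q k / 2)) * (ennreal (exp (- Q k / 2)) * (\<integral>\<^sup>+x. ennreal (exp (x \<bullet> k)) \<partial>M))"
    by simp
  also have "\<dots> = (\<integral>\<^sup>+x. ennreal (exp (x \<bullet> k)) \<partial>M)"
    by (simp add: mult.assoc[symmetric] ennreal_mult[symmetric] exp_add[symmetric])
  finally show ?thesis by simp
qed

text \<open>By duality, \<open>energy h\<close> is half the squared Cameron--Martin norm of \<open>h\<close>, and \<open>cm_space\<close>,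
  where it is finite, is the range of the square root of \<open>S\<close>.\<close>

definition cm_space :: "'a set" where "cm_space = {h. bdd_above (range (\<lambda>k. h \<bullet> k - Q k / 2))}"

definition energy :: "'a \<Rightarrow> real" where "energy h = (SUP k. h \<bullet> k - Q k / 2)"

lemma energy_ge: "h \<in> cm_space \<Longrightarrow> h \<bullet> k - Q k / 2 \<le> energy h"
  unfolding energy_def cm_space_def by (rule cSUP_upper) auto

lemma energy_leI: "(\<And>k. h \<bullet> k - Q k / 2 \<le> c) \<Longrightarrow> h \<in> cm_space \<and> energy h \<le> c"
  unfolding energy_def cm_space_def by (auto intro!: bdd_aboveI cSUP_least)

text \<open>Completing the square: \<open>Q (k - j) \<ge> 0\<close>, so the supremum is attained at
  \<open>j = k\<close>.\<close>

lemma energy_S: "S k \<in> cm_space" "energy (S k) = Q k / 2"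
proof -
  have "S k \<bullet> j - Q j / 2 \<le> Q k / 2" for j
    using Q_nonneg[of "k + (-1) *\<^sub>R j"] unfolding Q_simps(1,2) by simp
  then have le: "S k \<in> cm_space \<and> energy (S k) \<le> Q k / 2" by (rule energy_leI)
  then have "S k \<bullet> k - Q k / 2 \<le> energy (S k)" by (intro energy_ge) simp
  then show "S k \<in> cm_space" "energy (S k) = Q k / 2" using le by (simp_all add: Q_def)
qed

lemma cm_space_uminus: assumes "h \<in> cm_space" shows "- h \<in> cm_space"
proof -
  have "(- h) \<bullet> k - Q k / 2 \<le> energy h" for k using energy_ge[OF assms, of "- k"] by (simp add: Q_simps)
  then show ?thesis using energy_leI by blast
qed

lemma energy_nonneg: "h \<in> cm_space \<Longrightarrow> 0 \<le> energy h"
  using energy_ge[of h 0] by (simp add: Q_simps)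

text \<open>The summand 1 keeps the bound positive even for \<open>S = 0\<close>, so that it may be
  divided by.\<close>

definition S_bound :: real where "S_bound = onorm S + 1"

lemma S_bound: "0 < S_bound" "Q k \<le> S_bound * (norm k)\<^sup>2"
proof -
  show "0 < S_bound" using onorm_pos_le[OF S_bounded_linear] by (simp add: S_bound_def)
  have "Q k \<le> norm (S k) * norm k" unfolding Q_def by (rule norm_cauchy_schwarz)
  also have "\<dots> \<le> (onorm S * norm k) * norm k" by (intro mult_right_mono onorm[OF S_bounded_linear]) simp
  also have "\<dots> \<le> S_bound * (norm k)\<^sup>2" by (simp add: S_bound_def power2_eq_square algebra_simps)
  finally show "Q k \<le> S_bound * (norm k)\<^sup>2" .
qed

text \<open>Test with the maximizer \<open>h / S_bound\<close> of the minorant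
  \<open>h \<bullet> k - S_bound * (norm k)\<^sup>2 / 2\<close>. This coercivity is what dominates
  the linear decay allowed for the potential.\<close>

lemma norm_le_energy: assumes "h \<in> cm_space" shows "(norm h)\<^sup>2 / (2 * S_bound) \<le> energy h"
proof -
  have "h \<bullet> ((1 / S_bound) *\<^sub>R h) - Q ((1 / S_bound) *\<^sub>R h) / 2 \<le> energy h" by (rule energy_ge[OF assms])
  moreover have "Q ((1 / S_bound) *\<^sub>R h) \<le> (1 / S_bound)\<^sup>2 * (S_bound * (norm h)\<^sup>2)"
    unfolding Q_simps(2) by (intro mult_left_mono S_bound) simp
  moreover have "(1 / S_bound)\<^sup>2 * (S_bound * (norm h)\<^sup>2) = (norm h)\<^sup>2 / S_bound"
    using S_bound(1) by (simp add: power2_eq_square)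
  moreover have "h \<bullet> ((1 / S_bound) *\<^sub>R h) = (norm h)\<^sup>2 / S_bound" by (simp add: power2_norm_eq_inner)
  moreover have "(norm h)\<^sup>2 / (2 * S_bound) = (norm h)\<^sup>2 / S_bound / 2" by simp
  ultimately show ?thesis by linarith
qed

text \<open>A near maximizer of \<open>k \<mapsto> z \<bullet> k - Q k / 2 - e * norm k\<close> satisfies the first-order condition
  approximately; moving it to the best point on its ray makes its value equal to \<open>energy (S k)\<close>.\<close>

lemma near_maximizer:
  assumes e: "0 \<le> e" and B: "\<And>k. z \<bullet> k - Q k / 2 - e * norm k \<le> B" and d: "0 < d"
  obtains k where "norm (z - S k) \<le> e + d" "Q k / 2 = z \<bullet> k - Q k / 2 - e * norm k"
proof -
  define \<psi> where "\<psi> k = z \<bullet> k - Q k / 2 - e * norm k" for k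
  have bdd: "bdd_above (range \<psi>)" using B by (auto simp: \<psi>_def intro!: bdd_aboveI)
  define s where "s = Sup (range \<psi>)"
  have le_s: "\<psi> k \<le> s" for k unfolding s_def by (rule cSup_upper[OF _ bdd]) simp
  \<comment> \<open>The length of the test step \<open>v\<close> below. Its quadratic loss
    \<open>Q v / 2\<close> is at most \<open>d * t / 2\<close>, and the slack
    \<open>\<delta>\<close> costs the same again; after division by \<open>t\<close> exactly
    \<open>e + d\<close> remains.\<close>
  define t where "t = d / S_bound"
  have t: "t > 0" "S_bound * t = d" using d S_bound(1) by (simp_all add: t_def)
  define \<delta> where "\<delta> = d * t / 2"
  have \<delta>: "\<delta> > 0" using t d by (simp add: \<delta>_def)
  have "s - \<delta> < Sup (range \<psi>)" using \<delta> by (simp add: s_def)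
  then obtain k0 where k0: "s - \<delta> < \<psi> k0" using less_cSup_iff[OF _ bdd] by auto
  obtain k where k: "\<psi> k0 \<le> \<psi> k" "Q k / 2 = \<psi> k"
  proof -
    define p where "p = z \<bullet> k0 - e * norm k0"
    have pk0: "\<psi> k0 = p - Q k0 / 2" by (simp add: \<psi>_def p_def)
    show ?thesis
    proof (cases "p \<le> 0 \<or> k0 = 0")
      case True
      have "\<psi> k0 \<le> 0"
      proof (cases "k0 = 0")
        case False
        then show ?thesis using True pk0 Q_nonneg[of k0] by linarith
      qed (simp add: \<psi>_def Q_simps)
      then show ?thesis by (intro that[of 0]) (simp_all add: \<psi>_def Q_simps)
    next
      case False
      then have q: "Q k0 > 0" "p > 0" using Q_pos by auto
      \<comment> \<open>The vertex of the parabola \<open>c * p - c\<^sup>2 * Q k0 / 2\<close>. For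
        \<open>p \<le> 0\<close>, treated above, the best point of the ray is its origin.\<close>
      define c where "c = p / Q k0"
      have c: "c > 0" "c * Q k0 = p" using q by (simp_all add: c_def)
      have v: "\<psi> (c *\<^sub>R k0) = c * p - c\<^sup>2 * Q k0 / 2"
        using c by (simp add: \<psi>_def p_def Q_simps algebra_simps)
      have w: "c\<^sup>2 * Q k0 = c * p" using c by (simp add: power2_eq_square mult.assoc)
      have "0 \<le> (c - 1)\<^sup>2 * Q k0" by simp
      then have "p - Q k0 / 2 \<le> c * p / 2" using c w by (simp add: power2_eq_square algebra_simps)
      then show ?thesis using v w pk0 by (intro that[of "c *\<^sub>R k0"]) (auto simp: Q_simps)
    qed
  qed
  define w where "w = z - S k"
  have "norm w \<le> e + d"
  proof (cases "w = 0")
    case False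
    define v where "v = (t / norm w) *\<^sub>R w"
    have nv: "norm v = t" using False t by (simp add: v_def)
    have wv: "w \<bullet> v = t * norm w" using False by (simp add: v_def power2_norm_eq_inner[symmetric] power2_eq_square)
    have "\<psi> (k + v) - \<psi> k = w \<bullet> v - Q v / 2 - e * (norm (k + v) - norm k)"
      by (simp add: \<psi>_def w_def Q_simps inner_add_right inner_diff_left algebra_simps)
    moreover have "e * (norm (k + v) - norm k) \<le> e * t"
      using norm_triangle_ineq[of k v] nv e by (intro mult_left_mono) auto
    moreover have "Q v \<le> d * t" using S_bound(2)[of v] nv t(2) by (simp add: power2_eq_square mult.assoc[symmetric])
    moreover have "\<psi> (k + v) < \<psi> k + \<delta>" using le_s[of "k + v"] k0 k(1) by linarith
    ultimately have "t * norm w \<le> t * (e + d)" unfolding wv \<delta>_def by (simp add: algebra_simps)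
    then show ?thesis using t(1) by simp
  qed (use e d in auto)
  then have "norm (z - S k) \<le> e + d" by (simp only: w_def)
  then show ?thesis using k(2)[unfolded \<psi>_def] by (rule that)
qed

text \<open>\<open>near_maximizer\<close> with \<open>e = 0\<close>. Estimates known for shifts by
  \<open>S k\<close> pass to all of \<open>cm_space\<close> through this approximation.\<close>

lemma cm_space_approx:
  assumes "h \<in> cm_space" "0 < d"
  obtains k where "norm (h - S k) \<le> d" "Q k / 2 \<le> energy h"
proof -
  obtain k where "norm (h - S k) \<le> 0 + d" "Q k / 2 = h \<bullet> k - Q k / 2 - 0 * norm k"
    by (rule near_maximizer[of 0 h "energy h" d]) (use assms energy_ge[OF assms(1)] in auto)
  then show ?thesis using energy_ge[OF assms(1), of k] by (intro that[of k]) simp_all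
qed

text \<open>Replacing \<open>h\<close> by a nearby \<open>S k\<close> costs a little of the radius;
  continuity of the measure along increasing balls recovers it.\<close>

lemma measure_ball_ge:
  assumes h: "h \<in> cm_space"
  shows "exp (- energy h) * measure M (ball 0 e) \<le> measure M (ball h e)"
proof (rule LIMSEQ_le_const2)
  show "(\<lambda>n. exp (- energy h) * measure M (cball 0 (e - 1 / Suc n))) \<longlonglongrightarrow> exp (- energy h) * measure M (ball 0 e)"
    by (intro tendsto_mult_left ball_limit)
  show "\<exists>N. \<forall>n\<ge>N. exp (- energy h) * measure M (cball 0 (e - 1 / Suc n)) \<le> measure M (ball h e)"
  proof (intro exI allI impI)
    fix n
    define r where "r = 1 / real (Suc n)"
    have r: "r > 0" by (simp add: r_def)
    obtain k where k: "norm (h - S k) \<le> r / 2" "Q k / 2 \<le> energy h"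
      using cm_space_approx[OF h, of "r / 2"] r by auto
    have "measure M (cball 0 (e - r)) \<le> measure M (ball 0 (e - r / 2))"
      by (rule finite_measure_mono) (use r in auto)
    then have "exp (- energy h) * measure M (cball 0 (e - r)) \<le> exp (- Q k / 2) * measure M (ball 0 (e - r / 2))"
      using k by (intro mult_mono) auto
    also have "\<dots> \<le> measure M (ball (S k) (e - r / 2))" by (rule measure_ball_S_ge)
    also have "\<dots> \<le> measure M (ball h e)"
    proof (rule finite_measure_mono)
      show "ball (S k) (e - r / 2) \<subseteq> ball h e"
      proof
        fix x assume "x \<in> ball (S k) (e - r / 2)"
        then show "x \<in> ball h e" using k(1) dist_triangle[of h x "S k"] by (simp add: dist_norm)
      qed
    qed simp
    finally show "exp (- energy h) * measure M (cball 0 (e - 1 / Suc n)) \<le> measure M (ball h e)"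
      by (simp add: r_def)
  qed
qed

text \<open>\<open>measure_ball_le\<close> optimised over \<open>k\<close>. An unbounded exponent
  makes the ball null; otherwise \<open>near_maximizer\<close> with tolerance \<open>d = e\<close>
  gives the distance \<open>2 * e\<close>.\<close>

lemma measure_ball_zero_or_le:
  assumes "0 < e"
  shows "measure M (ball z e) = 0 \<or> (\<exists>k. norm (z - S k) \<le> 2 * e \<and> measure M (ball z e) \<le> exp (- Q k / 2) * measure M (ball 0 e))"
proof (cases "\<exists>B. \<forall>k. z \<bullet> k - Q k / 2 - e * norm k \<le> B")
  case True
  then obtain B where "\<And>k. z \<bullet> k - Q k / 2 - e * norm k \<le> B" by blast
  then obtain k where k: "norm (z - S k) \<le> e + e" "Q k / 2 = z \<bullet> k - Q k / 2 - e * norm k"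
    using near_maximizer[of e z B e] assms by auto
  have eq: "- (z \<bullet> k - Q k / 2) + e * norm k = - Q k / 2" using k(2) by linarith
  have "measure M (ball z e) \<le> exp (- Q k / 2) * measure M (ball 0 e)"
    using measure_ball_le[of z e k] unfolding eq .
  then show ?thesis using k(1) by auto
next
  case False
  have "measure M (ball z e) \<le> c" if "c > 0" for c
  proof -
    obtain k where k: "z \<bullet> k - Q k / 2 - e * norm k > - ln c" using False by (meson not_le)
    have "measure M (ball z e) \<le> exp (- (z \<bullet> k - Q k / 2) + e * norm k) * measure M (ball 0 e)"
      by (rule measure_ball_le)
    also have "\<dots> \<le> exp (ln c) * 1"
      using k by (intro mult_mono) auto
    finally show ?thesis using that by simp
  qed
  then have "measure M (ball z e) \<le> 0" by (rule field_le_epsilon[of "measure M (ball z e)" 0, simplified])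
  then show ?thesis using measure_nonneg[of M "ball z e"] by linarith
qed

text \<open>A quantitative form of absolute continuity that is uniform over bounded energy:
  \<open>t \<le> c + t\<^sup>2 / c\<close> splits the density and its second moment is \<open>exp (Q k)\<close>.\<close>

lemma emeasure_shift_le:
  assumes [measurable]: "A \<in> sets borel" and c: "c > 0"
  shows "emeasure M {x. x + S k \<in> A} \<le> ennreal (c * measure M A + exp (Q k) / c)"
proof -
  have "emeasure M {x. x + S k \<in> A} = (\<integral>\<^sup>+x. indicator A x * ennreal (exp (x \<bullet> k - Q k / 2)) \<partial>M)"
    by (rule emeasure_shift) simp
  also have "\<dots> \<le> (\<integral>\<^sup>+x. ennreal c * indicator A x + ennreal (exp (- Q k) / c) * ennreal (exp (x \<bullet> (2 *\<^sub>R k))) \<partial>M)"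
  proof (rule nn_integral_mono)
    fix x
    define t where "t = exp (x \<bullet> k - Q k / 2)"
    have t: "t > 0" by (simp add: t_def)
    have "t \<le> c + t\<^sup>2 / c"
    proof (cases "t \<le> c")
      case False
      then have "t * c \<le> t\<^sup>2" using t by (simp add: power2_eq_square)
      then have "t \<le> t\<^sup>2 / c" using c by (simp add: le_divide_eq)
      then show ?thesis using c by linarith
    next
      case True
      moreover have "0 \<le> t\<^sup>2 / c" using c by simp
      ultimately show ?thesis by linarith
    qed
    moreover have "t\<^sup>2 / c = exp (- Q k) / c * exp (x \<bullet> (2 *\<^sub>R k))"
      by (simp add: t_def exp_double[symmetric] exp_add[symmetric])
    ultimately have "ennreal t \<le> ennreal (c + exp (- Q k) / c * exp (x \<bullet> (2 *\<^sub>R k)))"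
      by (intro ennreal_leI) simp
    then have "ennreal t \<le> ennreal c + ennreal (exp (- Q k) / c) * ennreal (exp (x \<bullet> (2 *\<^sub>R k)))"
      using c by (subst ennreal_mult[symmetric]) (auto simp: ennreal_plus[symmetric] simp del: ennreal_plus)
    then show "indicator A x * ennreal (exp (x \<bullet> k - Q k / 2)) \<le> ennreal c * indicator A x + ennreal (exp (- Q k) / c) * ennreal (exp (x \<bullet> (2 *\<^sub>R k)))"
      unfolding t_def by (auto simp: indicator_def)
  qed
  also have "\<dots> = ennreal c * emeasure M A + ennreal (exp (- Q k) / c) * (\<integral>\<^sup>+x. ennreal (exp (x \<bullet> (2 *\<^sub>R k))) \<partial>M)"
    by (subst nn_integral_add) (auto simp: nn_integral_cmult_indicator nn_integral_cmult)
  also have "ennreal c * emeasure M A = ennreal (c * measure M A)"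
    using c by (simp add: emeasure_eq_measure ennreal_mult)
  also have "ennreal (exp (- Q k) / c) * (\<integral>\<^sup>+x. ennreal (exp (x \<bullet> (2 *\<^sub>R k))) \<partial>M) = ennreal (exp (- Q k) / c * exp (2 * Q k))"
    unfolding nn_integral_exp_inner using c by (subst ennreal_mult[symmetric]) (simp_all add: Q_simps)
  also have "exp (- Q k) / c * exp (2 * Q k) = exp (Q k) / c"
    by (simp add: exp_add[symmetric])
  also have "ennreal (c * measure M A) + ennreal (exp (Q k) / c) = ennreal (c * measure M A + exp (Q k) / c)"
    using c by (intro ennreal_plus[symmetric]) auto
  finally show ?thesis .
qed

text \<open>Enclose \<open>A\<close> in an open \<open>U\<close> of measure below
  \<open>1 / c\<^sup>2\<close>, so that both terms of \<open>emeasure_shift_le\<close> are of order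
  \<open>1 / c\<close>. If \<open>x + h\<close> lies in \<open>A\<close>, then
  \<open>x + S (k n)\<close> is eventually in \<open>U\<close>; Fatou's lemma carries the uniform
  bound to the limit, and \<open>c\<close> is arbitrary.\<close>

lemma shift_null_sets:
  assumes h: "h \<in> cm_space" and A: "A \<in> null_sets M"
  shows "{x. x + h \<in> A} \<in> null_sets M"
proof -
  have [measurable]: "A \<in> sets borel" using A by (auto simp: null_sets_def)
  have bound: "emeasure M {x. x + h \<in> A} \<le> ennreal ((1 + exp (2 * energy h)) / c)" if c: "c > 0" for c
  proof -
    have "(INF U \<in> {U. A \<subseteq> U \<and> open U}. emeasure M U) < ennreal (1 / c\<^sup>2)"
      using outer_regular[of M A] A c by (auto simp: null_sets_def)
    then obtain U where U: "A \<subseteq> U" "open U" "emeasure M U < ennreal (1 / c\<^sup>2)" by (auto simp: INF_less_iff)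
    then have mU: "c * measure M U \<le> 1 / c"
      using c by (simp add: emeasure_eq_measure ennreal_less_iff field_simps power2_eq_square)
    have [measurable]: "U \<in> sets borel" using U(2) by simp
    have "\<forall>n. \<exists>k. norm (h - S k) \<le> 1 / real (Suc n) \<and> Q k / 2 \<le> energy h"
      using cm_space_approx[OF h] by (metis of_nat_0_less_iff zero_less_Suc zero_less_divide_1_iff)
    then obtain k where k: "\<And>n. norm (h - S (k n)) \<le> 1 / real (Suc n)" "\<And>n. Q (k n) / 2 \<le> energy h" by metis
    have "(\<lambda>n. norm (h - S (k n))) \<longlonglongrightarrow> 0"
      by (rule tendsto_sandwich[OF _ _ tendsto_const LIMSEQ_Suc[OF lim_1_over_n]]) (use k(1) in auto)
    then have lim: "(\<lambda>n. S (k n)) \<longlonglongrightarrow> h"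
      by (subst tendsto_dist_iff) (simp add: dist_norm norm_minus_commute)
    have "emeasure M {x. x + h \<in> A} \<le> (\<integral>\<^sup>+x. liminf (\<lambda>n. indicator {x. x + S (k n) \<in> U} x) \<partial>M)"
    proof (subst nn_integral_indicator[symmetric], simp, rule nn_integral_mono)
      fix x
      show "indicator {x. x + h \<in> A} x \<le> liminf (\<lambda>n. indicator {x. x + S (k n) \<in> U} x :: ennreal)"
      proof (cases "x + h \<in> A")
        case True
        have "(\<lambda>n. x + S (k n)) \<longlonglongrightarrow> x + h" by (intro tendsto_intros lim)
        then have "\<forall>\<^sub>F n in sequentially. x + S (k n) \<in> U" by (rule topological_tendstoD) (use True U in auto)
        then have "\<forall>\<^sub>F n in sequentially. 1 \<le> (indicator {x. x + S (k n) \<in> U} x :: ennreal)"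
          by eventually_elim simp
        then show ?thesis using Liminf_bounded[of 1 _ sequentially] True by simp
      qed simp
    qed
    also have "\<dots> \<le> liminf (\<lambda>n. \<integral>\<^sup>+x. indicator {x. x + S (k n) \<in> U} x \<partial>M)"
      by (rule nn_integral_liminf) measurable
    also have "\<dots> \<le> liminf (\<lambda>n. ennreal ((1 + exp (2 * energy h)) / c))"
    proof (rule Liminf_mono, rule always_eventually, rule allI)
      fix n
      have "(\<integral>\<^sup>+x. indicator {x. x + S (k n) \<in> U} x \<partial>M) = emeasure M {x. x + S (k n) \<in> U}" by simp
      also have "\<dots> \<le> ennreal (c * measure M U + exp (Q (k n)) / c)" by (rule emeasure_shift_le) (use c in auto)
      also have "\<dots> \<le> ennreal ((1 + exp (2 * energy h)) / c)"
      proof (rule ennreal_leI)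
        have "exp (Q (k n)) / c \<le> exp (2 * energy h) / c" using k(2)[of n] c by (intro divide_right_mono) auto
        then show "c * measure M U + exp (Q (k n)) / c \<le> (1 + exp (2 * energy h)) / c"
          using mU by (simp add: add_divide_distrib)
      qed
      finally show "(\<integral>\<^sup>+x. indicator {x. x + S (k n) \<in> U} x \<partial>M) \<le> ennreal ((1 + exp (2 * energy h)) / c)" .
    qed
    also have "\<dots> = ennreal ((1 + exp (2 * energy h)) / c)" by (simp add: Liminf_const)
    finally show ?thesis .
  qed
  have "measure M {x. x + h \<in> A} \<le> \<epsilon>" if "\<epsilon> > 0" for \<epsilon>
  proof -
    have "0 < 1 + exp (2 * energy h)" by (simp add: add_pos_pos)
    then have "emeasure M {x. x + h \<in> A} \<le> ennreal \<epsilon>"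
      using bound[of "(1 + exp (2 * energy h)) / \<epsilon>"] that by simp
    then show ?thesis using that by (simp add: emeasure_eq_measure ennreal_le_iff)
  qed
  then have "measure M {x. x + h \<in> A} \<le> 0" by (rule field_le_epsilon[of _ 0, simplified])
  then show ?thesis using measure_nonneg[of M "{x. x + h \<in> A}"]
    by (auto simp: null_sets_def emeasure_eq_measure)
qed

lemma chernoff: "measure M {x. c \<le> x \<bullet> k} \<le> exp (Q k / 2 - c)"
proof -
  have "{x. c \<le> x \<bullet> k} = {x\<in>UNIV. 1 \<le> ennreal (exp (- c)) * ennreal (exp (x \<bullet> k))}"
    by (auto simp: ennreal_mult[symmetric] exp_add[symmetric] ennreal_ge_1)
  then have "emeasure M {x. c \<le> x \<bullet> k} \<le> ennreal (exp (- c)) * (\<integral>\<^sup>+x. ennreal (exp (x \<bullet> k)) * indicator UNIV x \<partial>M)"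
    using nn_integral_Markov_inequality[of "\<lambda>x. ennreal (exp (x \<bullet> k))" UNIV M "ennreal (exp (- c))"] by simp
  also have "\<dots> = ennreal (exp (Q k / 2 - c))"
    by (simp add: nn_integral_exp_inner ennreal_mult[symmetric] exp_add[symmetric])
  finally show ?thesis by (simp add: emeasure_eq_measure ennreal_le_iff)
qed

text \<open>For \<open>h\<close> outside \<open>cm_space\<close> the measure and its shift are
  mutually singular. Half-spaces cut at \<open>(h \<bullet> k n) / 2\<close>, midway between the two
  means, are crossed from either side with probability at most \<open>(1 / 2) ^ n\<close>, and
  Borel--Cantelli turns them into a separating null set \<open>N\<close>.\<close>

lemma equivalent_shifts_eq_cm_space: "equivalent_shifts M = cm_space"
proof (intro equalityI subsetI)
  fix h assume h: "h \<in> cm_space"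
  show "h \<in> equivalent_shifts M"
    unfolding equivalent_shifts_iff[OF sets_M]
  proof (intro ballI iffI)
    fix A :: "'a set" assume "{x. x + h \<in> A} \<in> null_sets M"
    from shift_null_sets[OF cm_space_uminus[OF h] this] show "A \<in> null_sets M" by simp
  qed (rule shift_null_sets[OF h])
next
  fix h assume eq: "h \<in> equivalent_shifts M"
  show "h \<in> cm_space"
  proof (rule ccontr)
    assume "h \<notin> cm_space"
    then have unb: "\<exists>k. h \<bullet> k - Q k / 2 > c" for c
      unfolding cm_space_def by (auto simp: bdd_above_def not_le)
    have "\<exists>k. exp (Q k / 2 - (h \<bullet> k) / 2) \<le> (1 / 2) ^ n" for n
    proof -
      \<comment> \<open>Halving \<open>j\<close> makes the Chernoff exponent
        \<open>- (h \<bullet> j - Q j / 2) / 4\<close>; hence the factor 4.\<close>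
      obtain j where "h \<bullet> j - Q j / 2 > 4 * (real n * ln 2)" using unb by blast
      then have "exp (Q ((1/2) *\<^sub>R j) / 2 - (h \<bullet> ((1/2) *\<^sub>R j)) / 2) \<le> exp (- (real n * ln 2))"
        by (simp add: Q_simps power2_eq_square)
      also have "\<dots> = (1 / 2) ^ n" by (simp add: exp_minus exp_of_nat_mult power_one_over inverse_eq_divide)
      finally show ?thesis by blast
    qed
    then obtain k where k: "\<And>n. exp (Q (k n) / 2 - (h \<bullet> k n) / 2) \<le> (1 / 2) ^ n" by metis
    define A where "A n = {x. (h \<bullet> k n) / 2 \<le> x \<bullet> k n}" for n
    define B where "B n = {x. (h \<bullet> k n) / 2 \<le> x \<bullet> (- k n)}" for n
    have [measurable]: "A n \<in> sets borel" "B n \<in> sets borel" for n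
      unfolding A_def B_def by measurable
    have mA: "measure M (A n) \<le> (1 / 2) ^ n" for n
      unfolding A_def by (rule order_trans[OF chernoff k])
    have mB: "measure M (B n) \<le> (1 / 2) ^ n" for n
      unfolding B_def using order_trans[OF chernoff[of "(h \<bullet> k n) / 2" "- k n"]] k[of n] by (simp add: Q_simps)
    have sum: "summable (\<lambda>n. measure M (A n))" "summable (\<lambda>n. measure M (B n))"
      by (rule summable_comparison_test'[OF summable_geometric[of "1/2::real"], of 0]; use mA mB in simp)+
    have aeA: "AE x in M. eventually (\<lambda>n. x \<in> space M - A n) sequentially"
      by (rule borel_cantelli_AE1) (use sum in \<open>auto simp: emeasure_eq_measure\<close>)
    have aeB: "AE x in M. eventually (\<lambda>n. x \<in> space M - B n) sequentially"
      by (rule borel_cantelli_AE1) (use sum in \<open>auto simp: emeasure_eq_measure\<close>)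
    define N where "N = {x. \<not> eventually (\<lambda>n. x \<notin> A n) sequentially}"
    have [measurable]: "N \<in> sets borel" unfolding N_def by measurable
    have "N \<in> null_sets M"
      using aeA by (subst AE_iff_null_sets) (auto simp: N_def)
    then have "{x. x + h \<in> N} \<in> null_sets M" using eq unfolding equivalent_shifts_iff[OF sets_M] by auto
    then have "AE x in M. x + h \<notin> N" by (subst (asm) AE_iff_null_sets) auto
    with aeB have "AE x in M. False"
    proof eventually_elim
      fix x assume "eventually (\<lambda>n. x \<in> space M - B n) sequentially" "x + h \<notin> N"
      then have "eventually (\<lambda>n. x \<notin> B n) sequentially" "eventually (\<lambda>n. x + h \<notin> A n) sequentially"
        by (auto simp: N_def)
      then have "eventually (\<lambda>n::nat. False) sequentially"
        by eventually_elim (auto simp: A_def B_def inner_add_left)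
      then show False by simp
    qed
    then show False by simp
  qed
qed

section \<open>Compactness of energy sublevel sets and limits of ball ratios\<close>

lemma closed_energy_le: "closed {h \<in> cm_space. energy h \<le> R}"
proof -
  have "h \<in> cm_space \<and> energy h \<le> R \<longleftrightarrow> (\<forall>k. h \<bullet> k - Q k / 2 \<le> R)" for h
    using energy_ge[of h] energy_leI[of h R] by (meson order_trans)
  then have "{h \<in> cm_space. energy h \<le> R} = (\<Inter>k. {h. h \<bullet> k - Q k / 2 \<le> R})" by auto
  also have "closed \<dots>" by (intro closed_INT ballI closed_Collect_le continuous_intros)
  finally show ?thesis .
qed

text \<open>Disjoint balls of a fixed radius around points of bounded energy all have measure at least a
  fixed positive constant, so there are only finitely many of them.\<close>

lemma compact_energy_le: "compact {h \<in> cm_space. energy h \<le> R}"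
  unfolding compact_eq_totally_bounded complete_eq_closed
proof (intro conjI closed_energy_le allI impI)
  let ?K = "{h \<in> cm_space. energy h \<le> R}"
  fix e :: real assume e: "e > 0"
  define c where "c = exp (- R) * measure M (ball 0 (e / 2))"
  have c: "c > 0" unfolding c_def using measure_ball_pos[of "e / 2"] e by simp
  define P where "P T \<longleftrightarrow> finite T \<and> T \<subseteq> ?K \<and> (\<forall>s\<in>T. \<forall>t\<in>T. s \<noteq> t \<longrightarrow> e \<le> dist s t)" for T
  have bound: "card T < Suc (nat \<lceil>1 / c\<rceil>)" if "P T" for T
  proof -
    have T: "finite T" "T \<subseteq> ?K" "\<And>s t. s \<in> T \<Longrightarrow> t \<in> T \<Longrightarrow> s \<noteq> t \<Longrightarrow> e \<le> dist s t" using that by (auto simp: P_def)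
    have "c \<le> measure M (ball t (e / 2))" if "t \<in> T" for t
    proof -
      have "c \<le> exp (- energy t) * measure M (ball 0 (e / 2))"
        unfolding c_def using T(2) that by (intro mult_right_mono) auto
      also have "\<dots> \<le> measure M (ball t (e / 2))" using T(2) that by (intro measure_ball_ge) auto
      finally show ?thesis .
    qed
    then have "card T * c \<le> (\<Sum>t\<in>T. measure M (ball t (e / 2)))" by (rule sum_bounded_below)
    also have "\<dots> = measure M (\<Union>t\<in>T. ball t (e / 2))"
    proof (rule finite_measure_finite_Union[symmetric])
      show "disjoint_family_on (\<lambda>t. ball t (e / 2)) T"
        unfolding disjoint_family_on_def
      proof (intro ballI impI)
        fix s t assume "s \<in> T" "t \<in> T" "s \<noteq> t"
        then show "ball s (e / 2) \<inter> ball t (e / 2) = {}" using T(3)[of s t] disjoint_ballI[of "e/2" "e/2" s t] by simp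
      qed
    qed (use T(1) in auto)
    also have "\<dots> \<le> 1" by simp
    finally have "card T \<le> 1 / c" using c by (simp add: field_simps)
    then have "card T \<le> nat \<lceil>1 / c\<rceil>" by (metis of_nat_le_iff order_trans real_nat_ceiling_ge)
    then show ?thesis by simp
  qed
  have "P {}" by (simp add: P_def)
  then obtain T where T: "P T" "\<And>T'. P T' \<Longrightarrow> card T' \<le> card T"
    using ex_has_greatest_nat[of P "{}" card] bound by blast
  have "?K \<subseteq> (\<Union>t\<in>T. ball t e)"
  proof
    fix x assume x: "x \<in> ?K"
    show "x \<in> (\<Union>t\<in>T. ball t e)"
    proof (rule ccontr)
      assume n: "x \<notin> (\<Union>t\<in>T. ball t e)"
      then have d: "\<And>t. t \<in> T \<Longrightarrow> e \<le> dist t x" by (auto simp: not_less)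
      then have "x \<notin> T" using e by force
      have "P (insert x T)" using T(1) x d unfolding P_def by (auto simp: dist_commute)
      then have "card (insert x T) \<le> card T" by (rule T(2))
      then show False using \<open>x \<notin> T\<close> T(1) by (simp add: P_def)
    qed
  qed
  then show "\<exists>k. finite k \<and> ?K \<subseteq> (\<Union>x\<in>k. ball x e)" using T(1) by (auto simp: P_def)
qed

text \<open>The value 0 off \<open>cm_space\<close> corresponds to infinite energy.\<close>

lemma measure_ball_ratio_tendsto:
  "((\<lambda>e. measure M (ball x e) / measure M (ball 0 e)) \<longlongrightarrow> (if x \<in> cm_space then exp (- energy x) else 0)) (at_right 0)"
proof (rule order_tendstoI)
  fix a assume a: "a < (if x \<in> cm_space then exp (- energy x) else 0)"
  show "\<forall>\<^sub>F e in at_right 0. a < measure M (ball x e) / measure M (ball 0 e)"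
    using eventually_at_right_less[of 0]
  proof eventually_elim
    fix e :: real assume "0 < e"
    then have p: "0 < measure M (ball 0 e)" by (rule measure_ball_pos)
    show "a < measure M (ball x e) / measure M (ball 0 e)"
    proof (cases "x \<in> cm_space")
      case True
      then have "exp (- energy x) \<le> measure M (ball x e) / measure M (ball 0 e)"
        using measure_ball_ge[OF True, of e] p by (simp add: le_divide_eq)
      then show ?thesis using a True by simp
    next
      case False
      then show ?thesis using a p by (simp add: less_le_trans)
    qed
  qed
next
  fix a assume a: "(if x \<in> cm_space then exp (- energy x) else 0) < a"
  have a0: "a > 0" using a by (auto split: if_splits intro: less_trans[OF exp_gt_zero])
  \<comment> \<open>The supremum over \<open>k\<close> is the energy on \<open>cm_space\<close> and
    infinite elsewhere, so one \<open>k\<close> beats \<open>- ln a\<close> in both cases. With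
    \<open>k\<close> fixed, the factor \<open>exp (e * norm k)\<close> tends to 1.\<close>
  have "\<exists>k. x \<bullet> k - Q k / 2 > - ln a"
  proof (rule ccontr)
    assume "\<not> ?thesis"
    then have "x \<in> cm_space \<and> energy x \<le> - ln a" by (intro energy_leI) (auto simp: not_less)
    then have "exp (ln a) \<le> exp (- energy x)" "x \<in> cm_space" by auto
    then show False using a a0 by simp
  qed
  then obtain k where "x \<bullet> k - Q k / 2 > - ln a" by blast
  then have "exp (- (x \<bullet> k - Q k / 2)) < exp (ln a)" by (subst exp_less_cancel_iff) linarith
  then have k: "exp (- (x \<bullet> k - Q k / 2) + 0 * norm k) < a" using a0 by simp
  have "((\<lambda>e. exp (- (x \<bullet> k - Q k / 2) + e * norm k)) \<longlongrightarrow> exp (- (x \<bullet> k - Q k / 2) + 0 * norm k)) (at_right 0)"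
    by (intro tendsto_intros)
  from order_tendstoD(2)[OF this k] eventually_at_right_less[of 0]
  show "\<forall>\<^sub>F e in at_right 0. measure M (ball x e) / measure M (ball 0 e) < a"
  proof eventually_elim
    fix e :: real assume e: "exp (- (x \<bullet> k - Q k / 2) + e * norm k) < a" "0 < e"
    then have "0 < measure M (ball 0 e)" by (intro measure_ball_pos)
    then have "measure M (ball x e) / measure M (ball 0 e) \<le> exp (- (x \<bullet> k - Q k / 2) + e * norm k)"
      using measure_ball_le[of x e k] by (simp add: divide_le_eq)
    then show "measure M (ball x e) / measure M (ball 0 e) < a" using e(1) by linarith
  qed
qed

end

section \<open>Modes of the posterior measure\<close>

locale gaussian_posterior = nondegenerate_gaussian M S
  for M :: "'a::{real_inner, polish_space} measure" and S +
  fixes N :: "'a measure" and \<Phi> :: "'a \<Rightarrow> real" and Z :: real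
  assumes prob_N: "prob_space N"
    and \<Phi>_measurable [measurable]: "\<Phi> \<in> borel_measurable borel"
    and Z_pos: "Z > 0"
    and N_eq: "N = density M (\<lambda>u. ennreal (exp (- \<Phi> u) / Z))"
    and lipschitz: "\<forall>r>0. \<exists>L>0. \<forall>x1\<in>ball 0 r. \<forall>x2\<in>ball 0 r. \<bar>\<Phi> x1 - \<Phi> x2\<bar> \<le> L * norm (x1 - x2)"
    and lower_bound: "\<exists>L\<ge>0. \<forall>x. \<Phi> x \<ge> \<Phi> 0 - L * norm x"
begin

interpretation N: prob_space N by (rule prob_N)

lemma sets_N [simp, measurable_cong]: "sets N = sets borel"
  by (simp add: N_eq)

lemma emeasure_N: "A \<in> sets borel \<Longrightarrow> emeasure N A = (\<integral>\<^sup>+x. ennreal (exp (- \<Phi> x) / Z) * indicator A x \<partial>M)"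
  unfolding N_eq by (rule emeasure_density) auto

lemma null_sets_N: "null_sets N = null_sets M"
proof -
  have "A \<in> null_sets N \<longleftrightarrow> A \<in> null_sets M" for A
  proof -
    have pos: "ennreal (exp (- \<Phi> x) / Z) \<noteq> 0" for x
      using Z_pos by (simp add: ennreal_eq_0_iff not_le)
    have "A \<in> null_sets N \<longleftrightarrow> A \<in> sets M \<and> (AE x in M. x \<in> A \<longrightarrow> ennreal (exp (- \<Phi> x) / Z) = 0)"
      unfolding N_eq by (rule null_sets_density_iff) measurable
    also have "\<dots> \<longleftrightarrow> A \<in> sets M \<and> (AE x in M. x \<notin> A)"
      by (simp only: pos simp_thms)
    also have "\<dots> \<longleftrightarrow> A \<in> null_sets M" using AE_iff_null_sets[of A M] null_setsD2[of A M] by blast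
    finally show ?thesis .
  qed
  then show ?thesis by blast
qed

lemma equivalent_shifts_N: "equivalent_shifts N = cm_space"
proof -
  have "equivalent_shifts N = equivalent_shifts M"
    by (intro set_eqI) (simp add: equivalent_shifts_iff null_sets_N)
  then show ?thesis by (simp add: equivalent_shifts_eq_cm_space)
qed

lemma measure_N_le:
  assumes [measurable]: "A \<in> sets borel" and c: "\<And>x. x \<in> A \<Longrightarrow> c \<le> \<Phi> x"
  shows "measure N A \<le> exp (- c) / Z * measure M A"
proof -
  have "emeasure N A \<le> (\<integral>\<^sup>+x. ennreal (exp (- c) / Z) * indicator A x \<partial>M)"
    unfolding emeasure_N[OF assms(1)]
    using c Z_pos by (intro nn_integral_mono) (auto simp: indicator_def intro!: ennreal_leI divide_right_mono)
  also have "\<dots> = ennreal (exp (- c) / Z) * emeasure M A" by (rule nn_integral_cmult_indicator) simp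
  finally show ?thesis using Z_pos
    by (simp add: emeasure_eq_measure N.emeasure_eq_measure ennreal_mult[symmetric] ennreal_le_iff)
qed

lemma measure_N_ge:
  assumes [measurable]: "A \<in> sets borel" and c: "\<And>x. x \<in> A \<Longrightarrow> \<Phi> x \<le> c"
  shows "exp (- c) / Z * measure M A \<le> measure N A"
proof -
  have "ennreal (exp (- c) / Z) * emeasure M A = (\<integral>\<^sup>+x. ennreal (exp (- c) / Z) * indicator A x \<partial>M)"
    by (rule nn_integral_cmult_indicator[symmetric]) simp
  also have "\<dots> \<le> emeasure N A"
    unfolding emeasure_N[OF assms(1)]
    using c Z_pos by (intro nn_integral_mono) (auto simp: indicator_def intro!: ennreal_leI divide_right_mono)
  finally show ?thesis using Z_pos
    by (simp add: emeasure_eq_measure N.emeasure_eq_measure ennreal_mult[symmetric] ennreal_le_iff)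
qed

lemma \<Phi>_near:
  obtains L where "L > 0" "\<And>x y. norm x < r \<Longrightarrow> norm y < r \<Longrightarrow> \<bar>\<Phi> x - \<Phi> y\<bar> \<le> L * norm (x - y)"
proof (cases "r > 0")
  case True
  then show ?thesis using lipschitz that by (auto simp: Ball_def)
next
  case False
  show ?thesis
  proof (rule that[of 1])
    fix x y :: 'a assume "norm x < r"
    then show "\<bar>\<Phi> x - \<Phi> y\<bar> \<le> 1 * norm (x - y)" using False norm_ge_zero[of x] by linarith
  qed simp
qed

lemma \<Phi>_tendsto:
  assumes f: "(f \<longlongrightarrow> l) F"
  shows "((\<lambda>n. \<Phi> (f n)) \<longlongrightarrow> \<Phi> l) F"
proof -
  obtain L where L: "L > 0" "\<And>x y. norm x < norm l + 1 \<Longrightarrow> norm y < norm l + 1 \<Longrightarrow> \<bar>\<Phi> x - \<Phi> y\<bar> \<le> L * norm (x - y)"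
    using \<Phi>_near by blast
  have ev: "eventually (\<lambda>n. norm (f n) < norm l + 1) F"
    by (rule order_tendstoD(2)[OF tendsto_norm[OF f]]) simp
  have "((\<lambda>n. L * norm (f n - l)) \<longlongrightarrow> L * norm (l - l)) F"
    by (intro tendsto_intros f)
  then have z: "((\<lambda>n. L * norm (f n - l)) \<longlongrightarrow> 0) F" by simp
  have "((\<lambda>n. \<Phi> (f n) - \<Phi> l) \<longlongrightarrow> 0) F"
    by (rule Lim_null_comparison[OF _ z]) (use ev in eventually_elim, use L in auto)
  then show ?thesis by (rule LIM_zero_cancel)
qed

section \<open>The Onsager--Machlup functional and its minimizers\<close>

definition om :: "'a \<Rightarrow> real" where "om x = \<Phi> x + energy x"

text \<open>Extension by 0 to points of infinite energy lets a single limit statement cover all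
  centres.\<close>

definition om_weight :: "'a \<Rightarrow> real" where
  "om_weight x = (if x \<in> cm_space then exp (- om x) / Z else 0)"

text \<open>On a ball of radius \<open>e\<close> the potential differs from its value at the centre
  by at most \<open>L * e\<close>, so the posterior mass is squeezed between multiples of the prior
  mass.\<close>

lemma measure_N_ball_tendsto:
  "((\<lambda>e. measure N (ball x e) / measure M (ball 0 e)) \<longlongrightarrow> om_weight x) (at_right 0)"
proof -
  let ?\<rho> = "\<lambda>e. measure M (ball x e) / measure M (ball 0 e)"
  obtain L where L: "L > 0" "\<And>y z. norm y < norm x + 1 \<Longrightarrow> norm z < norm x + 1 \<Longrightarrow> \<bar>\<Phi> y - \<Phi> z\<bar> \<le> L * norm (y - z)"
    using \<Phi>_near by blast
  have near: "\<bar>\<Phi> y - \<Phi> x\<bar> \<le> L * e" if "e < 1" "y \<in> ball x e" for e y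
  proof -
    have n: "norm (y - x) < e" using that by (simp add: dist_norm norm_minus_commute)
    then have "norm y < norm x + 1" using norm_triangle_ineq[of "y - x" x] that by simp
    then have "\<bar>\<Phi> y - \<Phi> x\<bar> \<le> L * norm (y - x)" by (intro L) auto
    also have "\<dots> \<le> L * e" using n L by simp
    finally show ?thesis .
  qed
  have lim: "om_weight x = exp (- \<Phi> x) / Z * (if x \<in> cm_space then exp (- energy x) else 0)"
    by (simp add: om_weight_def om_def exp_add[symmetric])
  have ev: "eventually (\<lambda>e::real. 0 < e \<and> e < 1) (at_right 0)"
    by (auto simp: eventually_at_right[of 0 1] intro!: exI[of _ 1])
  have sandwich: "exp (- (\<Phi> x + L * e)) / Z * ?\<rho> e \<le> measure N (ball x e) / measure M (ball 0 e) \<and>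
      measure N (ball x e) / measure M (ball 0 e) \<le> exp (- (\<Phi> x - L * e)) / Z * ?\<rho> e" if "0 < e \<and> e < 1" for e
  proof -
    have p: "measure M (ball 0 e) > 0" using that by (intro measure_ball_pos) simp
    have "exp (- (\<Phi> x + L * e)) / Z * measure M (ball x e) \<le> measure N (ball x e)"
      by (rule measure_N_ge) (use near[of e] that in \<open>force simp: abs_le_iff\<close>)+
    moreover have "measure N (ball x e) \<le> exp (- (\<Phi> x - L * e)) / Z * measure M (ball x e)"
      by (rule measure_N_le) (use near[of e] that in \<open>force simp: abs_le_iff\<close>)+
    ultimately show ?thesis using p
      by (metis (no_types, lifting) divide_right_mono less_imp_le times_divide_eq_right)
  qed
  have l: "((\<lambda>e. exp (- (\<Phi> x + c * e)) / Z * ?\<rho> e) \<longlongrightarrow> om_weight x) (at_right 0)" for c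
  proof -
    have "((\<lambda>e. exp (- (\<Phi> x + c * e)) / Z * ?\<rho> e) \<longlongrightarrow> exp (- (\<Phi> x + c * 0)) / Z * (if x \<in> cm_space then exp (- energy x) else 0)) (at_right 0)"
      by (intro tendsto_mult measure_ball_ratio_tendsto tendsto_divide tendsto_exp tendsto_minus tendsto_add tendsto_const tendsto_ident_at) (use Z_pos in simp)
    then show ?thesis by (simp add: lim)
  qed
  show ?thesis
    by (rule tendsto_sandwich[OF _ _ l[of L] l[of "- L"]]) (use ev in eventually_elim, use sandwich in simp)+
qed

text \<open>The direct method: half of the energy absorbs the linear decay of \<open>\<Phi>\<close>,
  so a minimizing sequence has bounded energy and a convergent subsequence.\<close>

lemma om_minimizer: obtains x where "x \<in> cm_space" "\<And>y. y \<in> cm_space \<Longrightarrow> om x \<le> om y"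
proof -
  obtain L where L: "L \<ge> 0" "\<And>x. \<Phi> 0 - L * norm x \<le> \<Phi> x" using lower_bound by blast
  let ?s = S_bound
  have s: "?s > 0" by (rule S_bound)
  \<comment> \<open>Young's inequality, weighted so that the quadratic term is at most half of the
    energy by \<open>norm_le_energy\<close>.\<close>
  have half: "L * norm h \<le> energy h / 2 + L\<^sup>2 * ?s" if "h \<in> cm_space" for h
  proof -
    have "L * norm h \<le> (norm h)\<^sup>2 / (4 * ?s) + L\<^sup>2 * ?s"
    proof -
      have "0 \<le> (norm h - 2 * L * ?s)\<^sup>2 / (4 * ?s)" using s by simp
      also have "\<dots> = (norm h)\<^sup>2 / (4 * ?s) - L * norm h + L\<^sup>2 * ?s"
        using s by (simp add: power2_eq_square field_simps)
      finally show ?thesis by simp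
    qed
    moreover have "(norm h)\<^sup>2 / (4 * ?s) = (norm h)\<^sup>2 / (2 * ?s) / 2" by simp
    ultimately show ?thesis using norm_le_energy[OF that] by linarith
  qed
  have low: "\<Phi> 0 + energy h / 2 - L\<^sup>2 * ?s \<le> om h" if "h \<in> cm_space" for h
    using half[OF that] L(2)[of h] unfolding om_def by linarith
  have bdd: "bdd_below (om ` cm_space)"
  proof (rule bdd_belowI2)
    fix h assume "h \<in> cm_space"
    then show "\<Phi> 0 - L\<^sup>2 * ?s \<le> om h" using low[of h] energy_nonneg[of h] by linarith
  qed
  have ne: "om ` cm_space \<noteq> {}" using energy_S(1) by auto
  define m where "m = Inf (om ` cm_space)"
  have m: "m \<le> om h" if "h \<in> cm_space" for h
    unfolding m_def by (rule cInf_lower) (use that bdd in auto)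
  have "\<exists>h\<in>cm_space. om h < m + 1 / real (Suc n)" for n
    using cInf_less_iff[OF ne bdd, of "m + 1 / real (Suc n)"] by (auto simp: m_def)
  then obtain h where h: "\<And>n. h n \<in> cm_space" "\<And>n. om (h n) < m + 1 / real (Suc n)" by metis
  define R where "R = 2 * (m + 1 - \<Phi> 0 + L\<^sup>2 * ?s)"
  have "energy (h n) \<le> R" for n
  proof -
    have "om (h n) < m + 1 / real (Suc n)" by (rule h)
    also have "\<dots> \<le> m + 1" by simp
    finally show ?thesis using low[OF h(1), of n] unfolding R_def by argo
  qed
  then have "\<forall>n. h n \<in> {h \<in> cm_space. energy h \<le> R}" using h by simp
  then obtain l r where l: "strict_mono (r :: nat \<Rightarrow> nat)" "(h \<circ> r) \<longlonglongrightarrow> l"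
    using seq_compactE[OF compact_imp_seq_compact[OF compact_energy_le[of R]]] by blast
  \<comment> \<open>The energy is only lower semicontinuous, so the limit is taken for each fixed
    \<open>k\<close> and the supremum afterwards.\<close>
  have "l \<bullet> k - Q k / 2 + \<Phi> l \<le> m + 0" for k
  proof (rule LIMSEQ_le)
    show "(\<lambda>n. (h \<circ> r) n \<bullet> k - Q k / 2 + \<Phi> ((h \<circ> r) n)) \<longlonglongrightarrow> l \<bullet> k - Q k / 2 + \<Phi> l"
      by (intro tendsto_intros \<Phi>_tendsto l)
    have "(\<lambda>n. 1 / real (Suc n)) \<longlonglongrightarrow> 0" by (rule LIMSEQ_Suc[OF lim_1_over_n])
    then show "(\<lambda>n. m + 1 / real (Suc (r n))) \<longlonglongrightarrow> m + 0"
      using LIMSEQ_subseq_LIMSEQ[OF _ l(1)] by (intro tendsto_intros) (force simp: o_def)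
    have "(h \<circ> r) n \<bullet> k - Q k / 2 + \<Phi> ((h \<circ> r) n) \<le> m + 1 / real (Suc (r n))" for n
      using energy_ge[OF h(1), of "r n" k] h(2)[of "r n"] unfolding om_def by simp
    then show "\<exists>N. \<forall>n\<ge>N. (h \<circ> r) n \<bullet> k - Q k / 2 + \<Phi> ((h \<circ> r) n) \<le> m + 1 / real (Suc (r n))" by blast
  qed
  then have "l \<in> cm_space \<and> energy l \<le> m - \<Phi> l" by (intro energy_leI) (simp add: algebra_simps)
  then show ?thesis using m by (intro that[of l]) (force simp: om_def)+
qed

text \<open>Ball centres \<open>z\<close> need not lie in \<open>cm_space\<close>, but they may be compared with a nearby point of
  the range of \<open>S\<close>; far away from the origin the quadratic growth of the energy beats the linear
  growth of \<open>- \<Phi>\<close>.\<close>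

lemma measure_N_ball_le:
  assumes min: "\<And>y. y \<in> cm_space \<Longrightarrow> m \<le> om y"
  obtains C where "\<And>e z. 0 < e \<Longrightarrow> e < 1 \<Longrightarrow> measure N (ball z e) \<le> exp (- m + C * e) / Z * measure M (ball 0 e)"
proof -
  obtain L where L: "L \<ge> 0" "\<And>x. \<Phi> 0 - L * norm x \<le> \<Phi> x" using lower_bound by blast
  let ?s = S_bound
  have s: "?s > 0" by (rule S_bound)
  \<comment> \<open>Chosen so that \<open>norm w \<ge> r\<close> gives \<open>3 \<le> norm w\<close>
    and \<open>2 * L * norm w \<le> energy w\<close>. Then
    \<open>L * (norm w + 3) \<le> energy w\<close>, and the far case reduces to
    \<open>m \<le> \<Phi> 0\<close>.\<close>
  define r where "r = 3 + 4 * ?s * L"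
  obtain K where K: "K > 0" "\<And>x y. norm x < r + 4 \<Longrightarrow> norm y < r + 4 \<Longrightarrow> \<bar>\<Phi> x - \<Phi> y\<bar> \<le> K * norm (x - y)"
    using \<Phi>_near by blast
  show ?thesis
  \<comment> \<open>A point of the ball is within \<open>e\<close> of \<open>z\<close>, and
    \<open>z\<close> within \<open>2 * e\<close> of \<open>S k\<close>; hence the 3.\<close>
  proof (rule that[of "3 * K"])
    fix e :: real and z assume e: "0 < e" "e < 1"
    let ?D = "measure M (ball 0 e)"
    have D: "?D > 0" using e by (intro measure_ball_pos)
    consider "measure M (ball z e) = 0" | k where "norm (z - S k) \<le> 2 * e" "measure M (ball z e) \<le> exp (- Q k / 2) * ?D"
      using measure_ball_zero_or_le[OF e(1), of z] by blast
    then show "measure N (ball z e) \<le> exp (- m + 3 * K * e) / Z * ?D"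
    proof cases
      case 1
      then have "ball z e \<in> null_sets N" unfolding null_sets_N by (auto simp: null_sets_def emeasure_eq_measure)
      then have "measure N (ball z e) = 0" by (auto simp: null_sets_def N.emeasure_eq_measure)
      then show ?thesis using Z_pos by simp
    next
      case (2 k)
      define w where "w = S k"
      have w: "w \<in> cm_space" "energy w = Q k / 2" unfolding w_def by (rule energy_S)+
      have dist_w: "norm (x - w) \<le> 3 * e" if "x \<in> ball z e" for x
        using that 2(1) norm_triangle_ineq[of "x - z" "z - w"] by (simp add: w_def dist_norm norm_minus_commute)
      have norm_x: "norm x \<le> norm w + 3" if "x \<in> ball z e" for x
        using dist_w[OF that] norm_triangle_ineq[of "x - w" w] e by simp
      have bound: "measure N (ball z e) \<le> exp (- m + 3 * K * e) / Z * ?D"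
        if c: "\<And>x. x \<in> ball z e \<Longrightarrow> c \<le> \<Phi> x" and cm: "m - 3 * K * e \<le> c + energy w" for c
      proof -
        have "measure N (ball z e) \<le> exp (- c) / Z * measure M (ball z e)" by (rule measure_N_le) (use c in auto)
        also have "\<dots> \<le> exp (- c) / Z * (exp (- Q k / 2) * ?D)" using 2(2) Z_pos by (intro mult_left_mono) auto
        also have "\<dots> = exp (- (c + energy w)) / Z * ?D" by (simp add: w exp_add[symmetric] mult.assoc[symmetric])
        also have "\<dots> \<le> exp (- m + 3 * K * e) / Z * ?D"
          using cm Z_pos by (intro mult_right_mono divide_right_mono) auto
        finally show ?thesis .
      qed
      show ?thesis
      proof (cases "norm w < r")
        case True
        show ?thesis
        proof (rule bound)
          show "m - 3 * K * e \<le> (\<Phi> w - 3 * K * e) + energy w" using min[OF w(1)] by (simp add: om_def)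
          fix x assume x: "x \<in> ball z e"
          have "\<bar>\<Phi> x - \<Phi> w\<bar> \<le> K * norm (x - w)" using True norm_x[OF x] by (intro K) auto
          also have "\<dots> \<le> K * (3 * e)" using dist_w[OF x] K(1) by simp
          finally show "\<Phi> w - 3 * K * e \<le> \<Phi> x" by (simp add: abs_le_iff)
        qed
      next
        case False
        show ?thesis
        proof (rule bound)
          fix x assume "x \<in> ball z e"
          then have "L * norm x \<le> L * (norm w + 3)" using norm_x L(1) by (intro mult_left_mono)
          then show "\<Phi> 0 - L * (norm w + 3) \<le> \<Phi> x" using L(2)[of x] by linarith
        next
          have "m \<le> \<Phi> 0" using min[OF energy_S(1)[of 0]] energy_S(2)[of 0] by (simp add: om_def S_simps Q_simps)
          moreover have "L * (norm w + 3) \<le> energy w"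
          proof -
            have "0 \<le> 4 * ?s * L" using s L(1) by simp
            then have nw: "3 \<le> norm w" "4 * ?s * L \<le> norm w" using False unfolding r_def by linarith+
            from nw(2) have "(4 * ?s * L) * norm w \<le> (norm w)\<^sup>2"
              unfolding power2_eq_square by (rule mult_right_mono) simp
            then have "2 * L * norm w \<le> (norm w)\<^sup>2 / (2 * ?s)" using s by (simp add: field_simps)
            moreover have "L * (norm w + 3) \<le> L * (2 * norm w)" using nw L(1) by (intro mult_left_mono) auto
            ultimately show ?thesis using norm_le_energy[OF w(1)] by linarith
          qed
          moreover have "0 \<le> 3 * K * e" using K e by simp
          ultimately show "m - 3 * K * e \<le> \<Phi> 0 - L * (norm w + 3) + energy w" by linarith
        qed
      qed
    qed
  qed
qed

section \<open>Limit of the supremum and identification of the modes\<close>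

lemma bdd_above_measure_N_ball: "bdd_above (range (\<lambda>z. measure N (ball z e)))"
  by (rule bdd_aboveI2[of _ _ 1]) simp

text \<open>The ball around the minimizer bounds the supremum from below, the estimate uniform in
  the centre from above; both have the same limit.\<close>

lemma SUP_measure_N_ball_tendsto:
  assumes x: "x \<in> cm_space" "\<And>y. y \<in> cm_space \<Longrightarrow> om x \<le> om y"
  shows "((\<lambda>e. (SUP z. measure N (ball z e)) / measure M (ball 0 e)) \<longlongrightarrow> exp (- om x) / Z) (at_right 0)"
proof -
  obtain C where C: "\<And>e z. 0 < e \<Longrightarrow> e < 1 \<Longrightarrow> measure N (ball z e) \<le> exp (- om x + C * e) / Z * measure M (ball 0 e)"
    using measure_N_ball_le[OF x(2)] by blast
  have ev: "eventually (\<lambda>e::real. 0 < e \<and> e < 1) (at_right 0)"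
    by (auto simp: eventually_at_right[of 0 1] intro!: exI[of _ 1])
  have lower: "((\<lambda>e. measure N (ball x e) / measure M (ball 0 e)) \<longlongrightarrow> exp (- om x) / Z) (at_right 0)"
    using measure_N_ball_tendsto[of x] x(1) by (simp add: om_weight_def)
  have "((\<lambda>e. exp (- om x + C * e) / Z) \<longlongrightarrow> exp (- om x + C * 0) / Z) (at_right 0)"
    by (intro tendsto_intros) (use Z_pos in simp)
  then have upper: "((\<lambda>e. exp (- om x + C * e) / Z) \<longlongrightarrow> exp (- om x) / Z) (at_right 0)" by simp
  show ?thesis
  proof (rule tendsto_sandwich[OF _ _ lower upper])
    show "\<forall>\<^sub>F e in at_right 0. measure N (ball x e) / measure M (ball 0 e) \<le> (SUP z. measure N (ball z e)) / measure M (ball 0 e)"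
      by (intro always_eventually allI divide_right_mono cSUP_upper bdd_above_measure_N_ball) auto
    show "\<forall>\<^sub>F e in at_right 0. (SUP z. measure N (ball z e)) / measure M (ball 0 e) \<le> exp (- om x + C * e) / Z"
      using ev
    proof eventually_elim
      fix e :: real assume e: "0 < e \<and> e < 1"
      have "(SUP z. measure N (ball z e)) \<le> exp (- om x + C * e) / Z * measure M (ball 0 e)"
        by (rule cSUP_least) (use C e in auto)
      then show "(SUP z. measure N (ball z e)) / measure M (ball 0 e) \<le> exp (- om x + C * e) / Z"
        using measure_ball_pos[of e] e by (simp only: divide_le_eq) simp
    qed
  qed
qed

text \<open>The quotient in the definition converges to \<open>om_weight x / c\<close> at every
  point, with \<open>c\<close> the largest weight. Points outside \<open>cm_space\<close> have
  weight 0 and therefore cannot be modes.\<close>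

lemma strong_mode_iff: "strong_mode N x \<longleftrightarrow> x \<in> cm_space \<and> (\<forall>y\<in>cm_space. om x \<le> om y)"
proof -
  obtain x0 where x0: "x0 \<in> cm_space" "\<And>y. y \<in> cm_space \<Longrightarrow> om x0 \<le> om y" using om_minimizer by blast
  define c where "c = exp (- om x0) / Z"
  have c: "c > 0" using Z_pos by (simp add: c_def)
  have "((\<lambda>e. (measure N (ball x e) / measure M (ball 0 e)) / ((SUP z. measure N (ball z e)) / measure M (ball 0 e))) \<longlongrightarrow> om_weight x / c) (at_right 0)"
    unfolding c_def
    by (intro tendsto_divide measure_N_ball_tendsto SUP_measure_N_ball_tendsto x0) (use c c_def in auto)
  then have lim: "((\<lambda>e. measure N (ball x e) / (SUP z. measure N (ball z e))) \<longlongrightarrow> om_weight x / c) (at_right 0)"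
  proof (rule Lim_transform_eventually)
    show "\<forall>\<^sub>F e in at_right 0. (measure N (ball x e) / measure M (ball 0 e)) / ((SUP z. measure N (ball z e)) / measure M (ball 0 e)) =
        measure N (ball x e) / (SUP z. measure N (ball z e))"
      using eventually_at_right_less[of 0]
    proof eventually_elim
      fix e :: real assume "0 < e"
      then show "(measure N (ball x e) / measure M (ball 0 e)) / ((SUP z. measure N (ball z e)) / measure M (ball 0 e)) =
        measure N (ball x e) / (SUP z. measure N (ball z e))"
        using measure_ball_pos[of e] by simp
    qed
  qed
  have "strong_mode N x \<longleftrightarrow> om_weight x / c = 1"
  proof
    assume "strong_mode N x"
    then show "om_weight x / c = 1"
      unfolding strong_mode_def by (rule tendsto_unique[OF trivial_limit_at_right_real lim])
  next
    assume "om_weight x / c = 1"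
    with lim show "strong_mode N x" unfolding strong_mode_def by (simp only:)
  qed
  also have "\<dots> \<longleftrightarrow> om_weight x = c" using c by auto
  also have "\<dots> \<longleftrightarrow> x \<in> cm_space \<and> om x = om x0"
    using c Z_pos by (auto simp: om_weight_def c_def)
  also have "\<dots> \<longleftrightarrow> x \<in> cm_space \<and> (\<forall>y\<in>cm_space. om x \<le> om y)"
    using x0 by (auto intro: antisym)
  finally show ?thesis .
qed

lemma ball_ratio_tendsto:
  assumes "x \<in> cm_space" "y \<in> cm_space"
  shows "((\<lambda>e. measure N (ball x e) / measure N (ball y e)) \<longlongrightarrow> exp (om y - om x)) (at_right 0)"
proof -
  have "((\<lambda>e. (measure N (ball x e) / measure M (ball 0 e)) / (measure N (ball y e) / measure M (ball 0 e))) \<longlongrightarrow> om_weight x / om_weight y) (at_right 0)"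
    by (intro tendsto_divide measure_N_ball_tendsto) (use assms Z_pos in \<open>simp add: om_weight_def\<close>)
  also have "om_weight x / om_weight y = exp (om y - om x)"
    using assms Z_pos by (simp add: om_weight_def exp_diff[symmetric])
  finally show ?thesis
  proof (rule Lim_transform_eventually)
    show "\<forall>\<^sub>F e in at_right 0. (measure N (ball x e) / measure M (ball 0 e)) / (measure N (ball y e) / measure M (ball 0 e)) =
        measure N (ball x e) / measure N (ball y e)"
      using eventually_at_right_less[of 0]
    proof eventually_elim
      fix e :: real assume "0 < e"
      then show "(measure N (ball x e) / measure M (ball 0 e)) / (measure N (ball y e) / measure M (ball 0 e)) =
        measure N (ball x e) / measure N (ball y e)"
        using measure_ball_pos[of e] by simp
    qed
  qed
qed

text \<open>Limits are unique and \<open>exp\<close> is injective: the functional is determined on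
  \<open>cm_space\<close> up to an additive constant.\<close>

lemma onsager_machlup_iff: "onsager_machlup N I \<longleftrightarrow> (\<forall>x\<in>cm_space. \<forall>y\<in>cm_space. I y - I x = om y - om x)"
proof -
  have "((\<lambda>e. measure N (ball x e) / measure N (ball y e)) \<longlongrightarrow> exp (I y - I x)) (at_right 0) \<longleftrightarrow> I y - I x = om y - om x"
    if "x \<in> cm_space" "y \<in> cm_space" for x y
  proof
    assume "((\<lambda>e. measure N (ball x e) / measure N (ball y e)) \<longlongrightarrow> exp (I y - I x)) (at_right 0)"
    then have "exp (I y - I x) = exp (om y - om x)"
      by (rule tendsto_unique[OF trivial_limit_at_right_real _ ball_ratio_tendsto[OF that]])
    then show "I y - I x = om y - om x" by (simp only: exp_inj_iff)
  next
    assume "I y - I x = om y - om x"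
    then show "((\<lambda>e. measure N (ball x e) / measure N (ball y e)) \<longlongrightarrow> exp (I y - I x)) (at_right 0)"
      using ball_ratio_tendsto[OF that] by (simp only:)
  qed
  then show ?thesis unfolding onsager_machlup_def equivalent_shifts_N by blast
qed

text \<open>The middle conjunct shows that the quantification over \<open>I\<close> is not vacuous.
  Passing from \<open>om\<close> to an arbitrary \<open>I\<close> uses only differences of values,
  which determine the minimizers.\<close>

lemma modes_minimize_onsager_machlup:
  "(\<exists>x. strong_mode N x) \<and> (\<exists>I. onsager_machlup N I) \<and>
    (\<forall>I. onsager_machlup N I \<longrightarrow>
      (\<forall>x. strong_mode N x \<longleftrightarrow> is_arg_min I (\<lambda>z. z \<in> equivalent_shifts N) x))"
proof (intro conjI allI impI)
  show "\<exists>x. strong_mode N x" using om_minimizer unfolding strong_mode_iff by metis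
  show "\<exists>I. onsager_machlup N I" using onsager_machlup_iff[of om] by blast
  fix I x assume I: "onsager_machlup N I"
  have "om x \<le> om y \<longleftrightarrow> \<not> I y < I x" if "x \<in> cm_space" "y \<in> cm_space" for y
  proof -
    have "I y - I x = om y - om x" using I that unfolding onsager_machlup_iff by blast
    then show ?thesis by linarith
  qed
  then show "strong_mode N x \<longleftrightarrow> is_arg_min I (\<lambda>z. z \<in> equivalent_shifts N) x"
    unfolding strong_mode_iff is_arg_min_def equivalent_shifts_N by blast
qed

end

theorem theorem2p9:
  fixes \<mu>0 \<mu>y :: "'a::{real_inner, polish_space} measure"
    and \<Sigma> :: "'a \<Rightarrow> 'a" and \<Phi> :: "'a \<Rightarrow> real" and Z :: real
  assumes gaussian: "centered_gaussian \<mu>0 \<Sigma>"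
    and nondegenerate: "inj \<Sigma>"
    and prob: "prob_space \<mu>y"
    and meas: "\<Phi> \<in> borel_measurable borel"
    and Z_pos: "Z > 0"
    and dens: "\<mu>y = density \<mu>0 (\<lambda>u. ennreal (exp (- \<Phi> u) / Z))"
    and lipschitz: "\<forall>r>0. \<exists>L>0. \<forall>x1\<in>ball 0 r. \<forall>x2\<in>ball 0 r.
                      \<bar>\<Phi> x1 - \<Phi> x2\<bar> \<le> L * norm (x1 - x2)"
    and lower_bound: "\<exists>L\<ge>0. \<forall>x. \<Phi> x \<ge> \<Phi> 0 - L * norm x"
  shows "(\<exists>x. strong_mode \<mu>y x) \<and>
         (\<exists>I. onsager_machlup \<mu>y I) \<and>
         (\<forall>I. onsager_machlup \<mu>y I \<longrightarrow>
            (\<forall>x. strong_mode \<mu>y x \<longleftrightarrow> is_arg_min I (\<lambda>z. z \<in> equivalent_shifts \<mu>y) x))"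
proof -
  interpret gaussian_posterior \<mu>0 \<Sigma> \<mu>y \<Phi> Z
    by (intro gaussian_posterior.intro nondegenerate_gaussian.intro gaussian_posterior_axioms.intro assms)
  show ?thesis by (rule modes_minimize_onsager_machlup)
qed

end
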